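(* Let $T>0$, $\underline v>0$, $v\in L^\infty(\mathbb R;\mathbb R_{\ge \underline v})$ and $\lambda\in L^\infty((0,T);W^{1,\infty}(\mathbb R))$, and let $x_0\in\mathbb R$. Then: (i) There exists a unique solution $\mathcal X[v,\lambda](x_0;\cdot)$ (in the integral sense defined in the context) of the initial value problem $x'(t)=v(x(t))\lambda(t,x(t))$, $x(0)=x_0$, on $[0,T]$, and $\mathcal X[v,\lambda](x_0;\cdot)\in W^{1,\infty}((0,T))$. (ii) Define $\mathcal Z[v](x_0;x):=\int_{x_0}^{x}\frac{1}{v(s)}\,ds$ for $x\in\mathbb R$. For all $(x_0,v)\in\mathbb R\times L^\infty(\mathbb R;\mathbb R_{\ge\underline v})$ the map $\mathbb R\ni x\mapsto \mathcal Z[v](x_0;x)$ is invertible, with inverse denoted $\mathcal Z[v]^{-1}(x_0;\cdot):\mathbb R\to\mathbb R$. (iii) Let $\mathcal C[\lambda,\mathcal Z[v](x_0;\cdot)]$ denote the solution $c$ of the integral equation $$c(t)=\int_0^t\lambda\big(s,\mathcal Z[v]^{-1}(x_0;c(s))\big)\,ds\qquad\forall t\in[0,T].$$ Then $$\mathcal X[v,\lambda](x_0;t)=\mathcal Z[v]^{-1}\big(x_0;\mathcal C[\lambda,\mathcal Z[v](x_0;\cdot)](t)\big)\qquad\forall t\in[0,T].$$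
   Context: $L^\infty(\mathbb R;\mathbb R_{\ge\underline v})$ is the set of essentially bounded measurable functions on $\mathbb R$ with values in $[\underline v,\infty)$. Solution in the integral sense: a function $x\in C([0,T])$ is a solution of $x'(t)=v(x(t))\lambda(t,x(t))$, $x(0)=x_0$, if $$\int_{x_0}^{x(t)}\frac{1}{v(y)}\,dy=\int_0^t\lambda(s,x(s))\,ds\qquad\forall t\in[0,T].$$ *)

theory Defs
  imports "HOL-Analysis.Analysis" "HOL-Probability.Essential_Supremum"
begin

text \<open>
  All measure-theoretic notions refer to Lebesgue (not merely Borel) measurability, and elements
  of Lebesgue and Sobolev spaces are handled through representatives.
\<close>

definition Linf_norm :: "real set \<Rightarrow> (real \<Rightarrow> real) \<Rightarrow> ereal" where
  "Linf_norm S f = esssup (lebesgue_on S) (\<lambda>x. ereal \<bar>f x\<bar>)"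

definition Linf :: "real set \<Rightarrow> (real \<Rightarrow> real) set" where
  "Linf S = {f \<in> borel_measurable (lebesgue_on S). Linf_norm S f < \<infinity>}"

definition Linf_ge :: "real \<Rightarrow> (real \<Rightarrow> real) set" where
  "Linf_ge m = {v \<in> Linf UNIV. AE x in lebesgue. m \<le> v x}"

text \<open>
  Sobolev spaces on an open set \<open>S\<close> of the real line, with continuously differentiable test
  functions of compact support in \<open>S\<close>, as in Brezis, \<^emph>\<open>Functional Analysis, Sobolev Spaces and
  Partial Differential Equations\<close>, Section 8.2.
\<close>

definition C1c :: "real set \<Rightarrow> (real \<Rightarrow> real) set" where
  "C1c S = {\<phi>. \<phi> C1_differentiable_on UNIV \<and>
                compact (closure {x. \<phi> x \<noteq> 0}) \<and> closure {x. \<phi> x \<noteq> 0} \<subseteq> S}"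

definition is_weak_deriv :: "real set \<Rightarrow> (real \<Rightarrow> real) \<Rightarrow> (real \<Rightarrow> real) \<Rightarrow> bool" where
  "is_weak_deriv S f g \<longleftrightarrow> g \<in> Linf S \<and>
     (\<forall>\<phi>\<in>C1c S. (LINT x:S|lebesgue. (f x * deriv \<phi> x)) = - (LINT x:S|lebesgue. (g x * \<phi> x)))"

definition W1inf :: "real set \<Rightarrow> (real \<Rightarrow> real) set" where
  "W1inf S = {f \<in> Linf S. \<exists>g. is_weak_deriv S f g}"

text \<open>Weak derivatives are unique up to null sets, so the choice of one is immaterial.\<close>

definition W1inf_norm :: "real set \<Rightarrow> (real \<Rightarrow> real) \<Rightarrow> ereal" where
  "W1inf_norm S f = Linf_norm S f + Linf_norm S (SOME g. is_weak_deriv S f g)"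

text \<open>
  The space \<open>L\<^sup>\<infinity>((0,T); W\<^sup>1\<^sup>,\<^sup>\<infinity>(\<real>))\<close>.  Every element of \<open>W\<^sup>1\<^sup>,\<^sup>\<infinity>(\<real>)\<close> is identified with its unique
  continuous representative; this is what gives \<open>\<lambda>(s, x(s))\<close> a meaning.  Measurability in time is
  that of all point evaluations.  As point evaluations are continuous linear functionals on
  \<open>W\<^sup>1\<^sup>,\<^sup>\<infinity>(\<real>)\<close>, every strongly (Bochner) measurable essentially bounded map is included; since
  \<open>W\<^sup>1\<^sup>,\<^sup>\<infinity>(\<real>)\<close> is not separable, so are further maps such as translates \<open>h(x - t)\<close> of a bounded
  Lipschitz function.
\<close>

definition Linf_W1inf :: "real \<Rightarrow> (real \<Rightarrow> real \<Rightarrow> real) set" where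
  "Linf_W1inf T = {lam.
     (\<forall>x. (\<lambda>t. lam t x) \<in> borel_measurable (lebesgue_on {0<..<T})) \<and>
     (\<exists>M::real. AE t in lebesgue_on {0<..<T}.
        continuous_on UNIV (lam t) \<and> lam t \<in> W1inf UNIV \<and> W1inf_norm UNIV (lam t) \<le> ereal M)}"

text \<open>
  Functions on \<open>[0,T]\<close> are modelled as elements of \<^term>\<open>extensional {0..T}\<close>, so that unique
  existence is unique existence as a function on \<open>[0,T]\<close>.
\<close>

definition integral_solution ::
    "real \<Rightarrow> (real \<Rightarrow> real) \<Rightarrow> (real \<Rightarrow> real \<Rightarrow> real) \<Rightarrow> real \<Rightarrow> (real \<Rightarrow> real) \<Rightarrow> bool" where
  "integral_solution T v lam x0 x \<longleftrightarrow> continuous_on {0..T} x \<and>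
     (\<forall>t\<in>{0..T}. (LINT y=x0..x t|lebesgue. (1 / v y)) = (LINT s=0..t|lebesgue. (lam s (x s))))"

definition Xsol ::
    "real \<Rightarrow> (real \<Rightarrow> real) \<Rightarrow> (real \<Rightarrow> real \<Rightarrow> real) \<Rightarrow> real \<Rightarrow> real \<Rightarrow> real" where
  "Xsol T v lam x0 = (THE x. x \<in> extensional {0..T} \<and> integral_solution T v lam x0 x)"

definition Zmap :: "(real \<Rightarrow> real) \<Rightarrow> real \<Rightarrow> real \<Rightarrow> real" where
  "Zmap v x0 x = (LINT s=x0..x|lebesgue. (1 / v s))"

definition C_solution ::
    "real \<Rightarrow> (real \<Rightarrow> real \<Rightarrow> real) \<Rightarrow> (real \<Rightarrow> real) \<Rightarrow> (real \<Rightarrow> real) \<Rightarrow> bool" where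
  "C_solution T lam Z c \<longleftrightarrow> continuous_on {0..T} c \<and>
     (\<forall>t\<in>{0..T}. c t = (LINT s=0..t|lebesgue. (lam s (inv Z (c s)))))"

definition Csol :: "real \<Rightarrow> (real \<Rightarrow> real \<Rightarrow> real) \<Rightarrow> (real \<Rightarrow> real) \<Rightarrow> real \<Rightarrow> real" where
  "Csol T lam Z = (THE c. c \<in> extensional {0..T} \<and> C_solution T lam Z c)"

end

(*
  The transformation Z turns x' = v(x) lambda(t, x) into c' = lambda(t, Z^{-1}(c)), where the
  possibly discontinuous v has disappeared: since v is bounded above and below, Z is
  bi-Lipschitz, and the new right-hand side is Lipschitz in c, so that Banach's fixed point
  theorem applies in an exponentially weighted supremum norm.  By the integral notion of solution,
  x solves the original problem iff c = Z o x solves the new one.  The Lipschitz bound on lambda(t, .)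
  comes from its weak derivative, tested against smoothed indicator functions of intervals.  The
  solution is Lipschitz, and a Lipschitz function is the primitive of a bounded density: the
  Radon-Nikodym derivative of its Stieltjes measure, after adding a linear function.
*)

theory Submission
  imports Defs
begin

section \<open>Lebesgue integrals of bounded functions\<close>

text \<open>\<open>lam t\<close> is controlled only for almost every \<open>t\<close>, while the
  fixed point argument wants its bounds at all times; \<open>lam\<close> is therefore set to zero
  off a good set, which no integral notices. The resulting right-hand side is merely measurable in
  time, so inserting a continuous \<open>c\<close> needs its own measurability argument. Its
  Lipschitz constant is \<open>K * V\<close>: \<open>K\<close> bounds the norms of
  \<open>lam t\<close>, and \<open>V\<close>, an essential upper bound of \<open>v\<close>, is a
  Lipschitz constant of the inverse of \<open>Z\<close>. For the Sobolev regularity the solution is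
  never differentiated pointwise. Its density is only integrated against test functions, and
  integration by parts holds because the two sides differ by a function with quadratically small
  increments. The definitions use Lebesgue integrals over intervals with either orientation, most
  estimates use the gauge integral \<open>integral\<close>; the next lemmas translate between them
  for bounded measurable integrands.\<close>

lemma borel_measurable_lebesgue_AE_cong:
  fixes f g :: "real \<Rightarrow> real"
  assumes f: "f \<in> borel_measurable lebesgue" and ae: "AE x in lebesgue. f x = g x"
  shows "g \<in> borel_measurable lebesgue"
proof (rule measurableI)
  fix A :: "real set" assume A: "A \<in> sets borel"
  have 1: "f -` A \<inter> space lebesgue \<in> sets lebesgue"
    using f A by (rule measurable_sets)
  show "g -` A \<inter> space lebesgue \<in> sets lebesgue"
    by (rule completion.in_sets_AE[OF _ 1]) (use ae in \<open>auto elim!: eventually_mono\<close>)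
qed simp

lemma set_integrable_lebesgue_bounded:
  fixes g :: "real \<Rightarrow> real"
  assumes "g \<in> borel_measurable lebesgue" "AE x in lebesgue. \<bar>g x\<bar> \<le> C"
  shows "set_integrable lebesgue {a..b} g"
  unfolding set_integrable_def
  by (rule integrableI_bounded_set_indicator[where B=C])
    (use assms in \<open>auto simp: emeasure_lborel_Icc_eq elim!: eventually_mono\<close>)

lemma set_integral_lebesgue_Ioo:
  fixes g :: "real \<Rightarrow> real"
  assumes "set_integrable lebesgue {a..b} g"
  shows "(LINT x:{a<..<b}|lebesgue. g x) = integral {a..b} g"
proof -
  have "set_integrable lebesgue {a<..<b} g"
    by (rule set_integrable_subset[OF assms]) auto
  then show ?thesis
    by (simp add: set_lebesgue_integral_eq_integral integral_open_interval_real)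
qed

lemma interval_lebesgue_integral_eq_integral:
  fixes g :: "real \<Rightarrow> real"
  assumes "a \<le> b" "set_integrable lebesgue {a..b} g"
  shows "(LINT x=ereal a..ereal b|lebesgue. g x) = integral {a..b} g"
  using assms set_integral_lebesgue_Ioo[of a b g]
  by (simp add: interval_lebesgue_integral_le_eq)

lemma integral_AE_bounds:
  fixes g :: "real \<Rightarrow> real"
  assumes meas: "g \<in> borel_measurable lebesgue"
    and ae: "AE x in lebesgue. m \<le> g x \<and> g x \<le> M" and "a \<le> b"
  shows "m * (b - a) \<le> integral {a..b} g" "integral {a..b} g \<le> M * (b - a)"
proof -
  have "AE x in lebesgue. \<bar>g x\<bar> \<le> \<bar>m\<bar> + \<bar>M\<bar>"
    using ae by eventually_elim linarith
  then have g: "set_integrable lebesgue {a..b} g"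
    by (rule set_integrable_lebesgue_bounded[OF meas])
  have c: "set_integrable lebesgue {a..b} (\<lambda>x. k)" for k :: real
    by (rule set_integrable_lebesgue_bounded[where C="\<bar>k\<bar>"]) auto
  have k: "(LINT x:{a..b}|lebesgue. k) = k * (b - a)" for k :: real
    using c[of k] \<open>a \<le> b\<close> by (simp add: set_lebesgue_integral_eq_integral)
  have "(LINT x:{a..b}|lebesgue. m) \<le> (LINT x:{a..b}|lebesgue. g x)"
    by (rule set_integral_mono_AE[OF c g]) (use ae in auto)
  moreover have "(LINT x:{a..b}|lebesgue. g x) \<le> (LINT x:{a..b}|lebesgue. M)"
    by (rule set_integral_mono_AE[OF g c]) (use ae in auto)
  ultimately show "m * (b - a) \<le> integral {a..b} g" "integral {a..b} g \<le> M * (b - a)"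
    using g k by (simp_all add: set_lebesgue_integral_eq_integral)
qed

lemma interval_lebesgue_integral_diff:
  fixes g :: "real \<Rightarrow> real"
  assumes meas: "g \<in> borel_measurable lebesgue" and ae: "AE x in lebesgue. \<bar>g x\<bar> \<le> C"
    and "a \<le> b"
  shows "(LINT x=ereal c..ereal b|lebesgue. g x) - (LINT x=ereal c..ereal a|lebesgue. g x)
    = integral {a..b} g"
proof -
  note int = set_integrable_lebesgue_bounded[OF meas ae]
  have hk: "g integrable_on {p..q}" for p q
    using int[of p q] by (rule set_lebesgue_integral_eq_integral(1))
  have I: "(LINT x=ereal p..ereal q|lebesgue. g x)
      = (if p \<le> q then integral {p..q} g else - integral {q..p} g)" for p q
    using interval_lebesgue_integral_eq_integral[OF _ int]
    by (auto simp: interval_lebesgue_integral_def)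
  have comb: "p \<le> q \<Longrightarrow> q \<le> r \<Longrightarrow> integral {p..q} g + integral {q..r} g = integral {p..r} g"
    for p q r
    using Henstock_Kurzweil_Integration.integral_combine[OF _ _ hk] .
  show ?thesis
    \<comment> \<open>The three instances are the positions of the base point \<open>c\<close>: left
      of, inside, and right of \<open>{a..b}\<close>.\<close>
    using comb[of c a b] comb[of a c b] comb[of a b c] \<open>a \<le> b\<close> unfolding I
    by (auto split: if_splits)
qed

section \<open>Essential bounds and the norm of \<open>Linf\<close>\<close>

lemma Linf_iff:
  "f \<in> Linf S \<longleftrightarrow> f \<in> borel_measurable (lebesgue_on S) \<and> (\<exists>C. AE x in lebesgue_on S. \<bar>f x\<bar> \<le> C)"
proof safe
  assume f: "f \<in> Linf S"
  then show "f \<in> borel_measurable (lebesgue_on S)" by (simp add: Linf_def)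
  have *: "AE x in lebesgue_on S. ereal \<bar>f x\<bar> \<le> Linf_norm S f"
    unfolding Linf_norm_def by (rule esssup_AE)
  show "\<exists>C. AE x in lebesgue_on S. \<bar>f x\<bar> \<le> C"
  proof (cases "Linf_norm S f")
    case (real r)
    with * show ?thesis by auto
  next
    case PInf
    with f show ?thesis by (simp add: Linf_def)
  next
    \<comment> \<open>The essential supremum is minus infinity only when \<open>S\<close> is null;
      then every bound holds almost everywhere.\<close>
    case MInf
    with * show ?thesis by (auto elim!: eventually_mono intro!: exI[of _ 0])
  qed
next
  fix C assume f: "f \<in> borel_measurable (lebesgue_on S)" and "AE x in lebesgue_on S. \<bar>f x\<bar> \<le> C"
  then have "Linf_norm S f \<le> ereal C"
    unfolding Linf_norm_def by (intro esssup_I) auto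
  with f show "f \<in> Linf S" by (auto simp: Linf_def less_eq_ereal_def)
qed

text \<open>Over a null set the norm would be minus infinity; the line has positive measure, so the
  essential supremum of the constant 0 is 0. This lets each summand of \<open>W1inf_norm\<close> be
  bounded by the sum.\<close>

lemma Linf_norm_UNIV_nonneg: "0 \<le> Linf_norm UNIV f"
proof -
  have "esssup (lebesgue_on UNIV :: real measure) (\<lambda>x. 0 :: ereal)
      \<le> esssup (lebesgue_on UNIV) (\<lambda>x. ereal \<bar>f x\<bar>)"
    by (rule esssup_mono) auto
  then show ?thesis
    by (simp add: Linf_norm_def esssup_const emeasure_restrict_space)
qed

section \<open>Continuous functions with bounded weak derivative\<close>

text \<open>An antiderivative of the positive part: once continuously differentiable, which is the
  smoothness that \<open>C1c\<close> asks of a test function.\<close>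

definition quadratic_ramp :: "real \<Rightarrow> real" where "quadratic_ramp y = (max 0 y)\<^sup>2 / 2"

lemma quadratic_ramp_deriv: "(quadratic_ramp has_real_derivative max 0 y) (at y)"
proof (rule linorder_cases[of y 0])
  assume "y < 0"
  have "((\<lambda>_. 0) has_real_derivative max 0 y) (at y)"
    using \<open>y < 0\<close> by (auto intro!: derivative_eq_intros)
  then show ?thesis
    by (rule has_field_derivative_transform_within_open[of _ _ _ "{..<0}"])
      (use \<open>y < 0\<close> in \<open>auto simp: quadratic_ramp_def\<close>)
next
  assume "y = 0"
  have "((\<lambda>h::real. max 0 h / 2) \<longlongrightarrow> max 0 0 / 2) (at 0)"
    by (intro tendsto_intros) simp
  then have "((\<lambda>h. quadratic_ramp h / h) \<longlongrightarrow> max 0 0 / 2) (at 0)"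
    by (rule Lim_transform_eventually)
      (auto simp: eventually_at_filter quadratic_ramp_def max_def power2_eq_square)
  with \<open>y = 0\<close> show ?thesis by (simp add: DERIV_def quadratic_ramp_def)
next
  assume "0 < y"
  have "((\<lambda>y. y\<^sup>2 / 2) has_real_derivative max 0 y) (at y)"
    using \<open>0 < y\<close> by (auto intro!: derivative_eq_intros)
  then show ?thesis
    by (rule has_field_derivative_transform_within_open[of _ _ _ "{0<..}"])
      (use \<open>0 < y\<close> in \<open>auto simp: quadratic_ramp_def\<close>)
qed

(* The second difference of the quadratic ramp is C^1, and its derivative is a hat function. *)
definition smooth_step :: "real \<Rightarrow> real" where "smooth_step y = quadratic_ramp y - 2 * quadratic_ramp (y - 1) + quadratic_ramp (y - 2)"

text \<open>The tent over \<open>[0, 2]\<close> with value 1 at its peak 1. Its area is 1, so its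
  antiderivative rises from 0 to 1.\<close>

definition hat :: "real \<Rightarrow> real" where "hat y = max 0 y - 2 * max 0 (y - 1) + max 0 (y - 2)"

lemma smooth_step_deriv: "(smooth_step has_real_derivative hat y) (at y)"
proof -
  have *: "((\<lambda>y. quadratic_ramp (y - c)) has_real_derivative max 0 (y - c)) (at y)" for c
  proof -
    have "((\<lambda>y. y - c) has_real_derivative 1) (at y)" by (auto intro!: derivative_eq_intros)
    from DERIV_chain2[of quadratic_ramp, OF quadratic_ramp_deriv this] show ?thesis by simp
  qed
  show ?thesis unfolding smooth_step_def[abs_def] hat_def
    by (rule derivative_eq_intros * quadratic_ramp_deriv refl | simp)+
qed

lemma smooth_step_simps: "y \<le> 0 \<Longrightarrow> smooth_step y = 0" "2 \<le> y \<Longrightarrow> smooth_step y = 1"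
  by (auto simp: smooth_step_def quadratic_ramp_def abs_if field_simps power2_eq_square)

lemma hat_nonneg: "0 \<le> hat y"
  by (auto simp: hat_def max_def)

lemma hat_eq_0: "y \<le> 0 \<or> 2 \<le> y \<Longrightarrow> hat y = 0"
  by (auto simp: hat_def max_def)

lemma continuous_on_hat [continuous_intros]:
  "continuous_on S f \<Longrightarrow> continuous_on S (\<lambda>x. hat (f x))"
  unfolding hat_def by (intro continuous_intros)

lemma smooth_step_mono: "x \<le> y \<Longrightarrow> smooth_step x \<le> smooth_step y"
  by (rule DERIV_nonneg_imp_nondecreasing) (auto intro: smooth_step_deriv hat_nonneg)

lemma smooth_step_bounds: "0 \<le> smooth_step y" "smooth_step y \<le> 1"
  using smooth_step_mono[of "min y 0" y] smooth_step_mono[of y "max y 2"] smooth_step_simps by auto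

text \<open>The test function climbs from 0 to 1 just after \<open>a\<close> and descends just after
  \<open>b\<close>. Its derivative is a difference of two narrow bumps of mass 1, so pairing it with
  \<open>f\<close> nearly gives \<open>f a - f b\<close>; pairing the function itself with
  \<open>g\<close> gives at most \<open>M\<close> times the length of its support.\<close>

lemma weak_deriv_bounded_imp_Lipschitz:
  assumes cont: "continuous_on UNIV f"
    and weak: "is_weak_deriv UNIV f g"
    and bound: "AE x in lebesgue. \<bar>g x\<bar> \<le> M" and M: "0 \<le> M"
    and "a < b"
  shows "\<bar>f b - f a\<bar> \<le> M * (b - a)"
proof (rule field_le_epsilon)
  fix e :: real assume "0 < e"
  \<comment> \<open>Two errors \<open>e1\<close> arise from averaging \<open>f\<close> near
    \<open>a\<close> and near \<open>b\<close>, and one error \<open>M * e1\<close> from the excess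
    length \<open>2 * d\<close> of the support.\<close>
  define e1 where "e1 = e / (2 + M)"
  have e1: "0 < e1" using \<open>0 < e\<close> M by (simp add: e1_def)
  have near: "\<exists>d>0. \<forall>x. \<bar>x - c\<bar> < d \<longrightarrow> \<bar>f x - f c\<bar> < e1" for c
    using cont e1 by (auto simp: continuous_on_iff dist_real_def)
  obtain d1 where d1: "d1 > 0" "\<And>x. \<bar>x - a\<bar> < d1 \<Longrightarrow> \<bar>f x - f a\<bar> < e1" using near by blast
  obtain d2 where d2: "d2 > 0" "\<And>x. \<bar>x - b\<bar> < d2 \<Longrightarrow> \<bar>f x - f b\<bar> < e1" using near by blast
  define d where "d = min e1 (min d1 d2) / 3"
  have d: "0 < d" "2 * d < d1" "2 * d < d2" "2 * d \<le> e1" using d1(1) d2(1) e1 by (auto simp: d_def)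
  \<comment> \<open>The step and its derivative, moved to \<open>c\<close> and compressed so that
    the whole rise takes place on \<open>{c..c + 2 * d}\<close>.\<close>
  define S where "S = (\<lambda>c x. smooth_step ((x - c) / d))"
  define H where "H = (\<lambda>c x. hat ((x - c) / d) / d)"
  have S': "(S c has_real_derivative H c x) (at x)" for c x
  proof -
    have "((\<lambda>x. (x - c) / d) has_real_derivative 1 / d) (at x)"
      using d by (auto intro!: derivative_eq_intros)
    from DERIV_chain2[OF smooth_step_deriv this] show ?thesis
      unfolding S_def H_def by simp
  qed
  have contH: "continuous_on A (H c)" for A c
    unfolding H_def by (intro continuous_intros) (use d in auto)
  have H0: "H c x = 0" if "x \<notin> {c..c + 2 * d}" for c x
  proof -
    have "(x - c) / d \<le> 0 \<or> 2 \<le> (x - c) / d" using that d by (auto simp: field_simps)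
    then show ?thesis by (simp add: H_def hat_eq_0)
  qed
  have Hnn: "0 \<le> H c x" for c x using d hat_nonneg by (simp add: H_def)
  have fint: "(LINT x|lebesgue. f x * H c x) = integral {c..c + 2 * d} (\<lambda>x. f x * H c x)"
    and fintegrable: "integrable lebesgue (\<lambda>x. f x * H c x)" for c
  proof -
    have c: "continuous_on {c..c + 2 * d} (\<lambda>x. f x * H c x)"
      by (intro continuous_intros contH continuous_on_subset[OF cont]) auto
    then have i: "set_integrable lebesgue {c..c + 2 * d} (\<lambda>x. f x * H c x)"
      using absolutely_integrable_continuous_real by blast
    have eq: "(\<lambda>x. f x * H c x) = (\<lambda>x. indicator {c..c + 2 * d} x *\<^sub>R (f x * H c x))"
      using H0 by (auto simp: indicator_def fun_eq_iff)
    show "integrable lebesgue (\<lambda>x. f x * H c x)"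
      using i unfolding set_integrable_def by (subst eq)
    show "(LINT x|lebesgue. f x * H c x) = integral {c..c + 2 * d} (\<lambda>x. f x * H c x)"
      using set_lebesgue_integral_eq_integral(2)[OF i] unfolding set_lebesgue_integral_def by (subst eq)
  qed
  have near_int: "\<bar>(LINT x|lebesgue. f x * H c x) - f c\<bar> \<le> e1"
    if "\<And>x. \<bar>x - c\<bar> \<le> 2 * d \<Longrightarrow> \<bar>f x - f c\<bar> \<le> e1" for c
  proof -
    have "(H c has_integral (S c (c + 2 * d) - S c c)) {c..c + 2 * d}"
      by (rule fundamental_theorem_of_calculus)
        (use d S' in \<open>auto simp: has_real_derivative_iff_has_vector_derivative
          intro: has_vector_derivative_at_within\<close>)
    then have H1: "(H c has_integral 1) {c..c + 2 * d}"
      using d by (simp add: S_def smooth_step_simps)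
    have c: "continuous_on {c..c + 2 * d} (\<lambda>x. f x * H c x)"
      by (intro continuous_intros contH continuous_on_subset[OF cont]) auto
    have I: "((\<lambda>x. f x * H c x) has_integral (LINT x|lebesgue. f x * H c x)) {c..c + 2 * d}"
      unfolding fint by (rule integrable_integral) (rule integrable_continuous_interval[OF c])
    \<comment> \<open>\<open>f\<close> stays within \<open>e1\<close> of \<open>f c\<close> on the
      support of \<open>H c\<close>; as \<open>H c\<close> is nonnegative with integral 1, the
      average of \<open>f\<close> does too.\<close>
    have B: "(f c - e1) * H c x \<le> f x * H c x" "f x * H c x \<le> (f c + e1) * H c x"
      if "x \<in> {c..c + 2 * d}" for x
      using that \<open>\<And>x. \<bar>x - c\<bar> \<le> 2 * d \<Longrightarrow> \<bar>f x - f c\<bar> \<le> e1\<close>[of x] Hnn[of c x]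
      by (auto intro!: mult_right_mono simp: abs_le_iff)
    show ?thesis
      using has_integral_le[OF has_integral_mult_right[OF H1, of "f c - e1"] I B(1)]
        has_integral_le[OF I has_integral_mult_right[OF H1, of "f c + e1"] B(2)] by auto
  qed
  define \<phi> where "\<phi> = (\<lambda>x. S a x - S b x)"
  have \<phi>': "(\<phi> has_real_derivative H a x - H b x) (at x)" for x
    unfolding \<phi>_def by (intro DERIV_diff S')
  then have deriv: "deriv \<phi> x = H a x - H b x" for x by (rule DERIV_imp_deriv)
  have \<phi>0: "\<phi> x = 0" if "x \<notin> {a..b + 2 * d}" for x
  proof -
    have "(x - a) / d \<le> 0 \<and> (x - b) / d \<le> 0 \<or> 2 \<le> (x - a) / d \<and> 2 \<le> (x - b) / d"
      using that d \<open>a < b\<close> by (auto simp: field_simps)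
    then show ?thesis by (auto simp: \<phi>_def S_def smooth_step_simps)
  qed
  \<comment> \<open>The two rises may overlap; the bound needs only that both steps take values in
    \<open>[0, 1]\<close>.\<close>
  have \<phi>_bound: "\<bar>\<phi> x\<bar> \<le> 1" for x
    using smooth_step_bounds[of "(x - a) / d"] smooth_step_bounds[of "(x - b) / d"] by (auto simp: \<phi>_def S_def)
  have cont\<phi>: "continuous_on A \<phi>" for A
    using \<phi>' by (meson DERIV_isCont continuous_at_imp_continuous_on)
  have supp: "closure {x. \<phi> x \<noteq> 0} \<subseteq> {a..b + 2 * d}"
    by (rule closure_minimal) (use \<phi>0 in blast, simp)
  have "\<phi> \<in> C1c UNIV"
    unfolding C1c_def
  proof (intro CollectI conjI)
    show "\<phi> C1_differentiable_on UNIV"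
      unfolding C1_differentiable_on_def
      by (rule exI[of _ "\<lambda>x. H a x - H b x"])
        (use \<phi>' in \<open>auto simp: has_real_derivative_iff_has_vector_derivative intro!: continuous_intros contH\<close>)
    have "bounded (closure {x. \<phi> x \<noteq> 0})"
      by (rule bounded_subset[OF bounded_closed_interval supp])
    then show "compact (closure {x. \<phi> x \<noteq> 0})" by (simp add: compact_eq_bounded_closed)
  qed auto
  then have eq: "(LINT x|lebesgue. f x * deriv \<phi> x) = - (LINT x|lebesgue. g x * \<phi> x)"
    using weak by (auto simp: is_weak_deriv_def set_lebesgue_integral_def)
  have lhs: "(LINT x|lebesgue. f x * deriv \<phi> x)
      = (LINT x|lebesgue. f x * H a x) - (LINT x|lebesgue. f x * H b x)"
    unfolding deriv right_diff_distrib using fintegrable by simp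
  have g: "g \<in> borel_measurable lebesgue"
    using weak by (simp add: is_weak_deriv_def Linf_def lebesgue_on_UNIV_eq)
  have \<phi>_meas: "\<phi> \<in> borel_measurable lebesgue"
    using cont\<phi>[of UNIV] by (simp add: borel_measurable_continuous_onI measurable_completion)
  have "\<bar>LINT x|lebesgue. g x * \<phi> x\<bar> \<le> M * (b + 2 * d - a)"
  proof -
    have ae: "AE x in lebesgue. - M \<le> g x * \<phi> x \<and> g x * \<phi> x \<le> M"
      using bound
    proof eventually_elim
      case (elim x)
      have "\<bar>g x * \<phi> x\<bar> \<le> M * 1"
        unfolding abs_mult by (rule mult_mono) (use elim \<phi>_bound M in auto)
      then show ?case by (simp add: abs_le_iff)
    qed
    have m: "(\<lambda>x. g x * \<phi> x) \<in> borel_measurable lebesgue" using g \<phi>_meas by simp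
    have i: "set_integrable lebesgue {a..b + 2 * d} (\<lambda>x. g x * \<phi> x)"
      by (rule set_integrable_lebesgue_bounded[OF m, of M]) (use ae in \<open>auto elim: eventually_mono\<close>)
    have "(\<lambda>x. g x * \<phi> x) = (\<lambda>x. indicator {a..b + 2 * d} x *\<^sub>R (g x * \<phi> x))"
      using \<phi>0 by (auto simp: indicator_def fun_eq_iff)
    then have "(LINT x|lebesgue. g x * \<phi> x) = integral {a..b + 2 * d} (\<lambda>x. g x * \<phi> x)"
      using set_lebesgue_integral_eq_integral(2)[OF i] unfolding set_lebesgue_integral_def by simp
    then show ?thesis
      using integral_AE_bounds[OF m ae, of a "b + 2 * d"] \<open>a < b\<close> d by (auto simp: abs_le_iff)
  qed
  moreover have "\<bar>(LINT x|lebesgue. f x * H a x) - f a\<bar> \<le> e1"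
    by (rule near_int) (use d d1 in \<open>force intro: less_imp_le\<close>)
  moreover have "\<bar>(LINT x|lebesgue. f x * H b x) - f b\<bar> \<le> e1"
    by (rule near_int) (use d d2 in \<open>force intro: less_imp_le\<close>)
  moreover have "M * (b + 2 * d - a) \<le> M * (b - a) + M * e1"
    using d M mult_left_mono[of "2 * d" e1 M] by (simp add: algebra_simps)
  ultimately have "\<bar>f b - f a\<bar> \<le> M * (b - a) + (2 + M) * e1"
    using eq lhs distrib_right[of 2 M e1] by linarith
  also have "(2 + M) * e1 = e" using M by (simp add: e1_def)
  finally show "\<bar>f b - f a\<bar> \<le> M * (b - a) + e" .
qed

section \<open>Integral equations of Caratheodory type\<close>

text \<open>For a \<open>c\<close> with countably many values the composition is pieced together
  from countably many measurable sections. A general \<open>c\<close> is a pointwise limit of such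
  functions, and continuity in the second argument carries the limit over.\<close>

lemma Caratheodory_measurable:
  fixes f :: "'a \<Rightarrow> real \<Rightarrow> real"
  assumes meas: "\<And>z. (\<lambda>s. f s z) \<in> borel_measurable M"
    and cont: "\<And>s. s \<in> space M \<Longrightarrow> continuous_on UNIV (f s)"
    and c[measurable]: "c \<in> borel_measurable M"
  shows "(\<lambda>s. f s (c s)) \<in> borel_measurable M"
proof (rule borel_measurable_LIMSEQ_real)
  \<comment> \<open>\<open>c s\<close> rounded down to a multiple of \<open>1 / (n + 1)\<close>; the
    error is at most \<open>1 / (n + 1)\<close>.\<close>
  define q where "q = (\<lambda>(n::nat) s. of_int \<lfloor>real (Suc n) * c s\<rfloor> / real (Suc n))"
  show "(\<lambda>s. f s (q n s)) \<in> borel_measurable M" for n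
  proof -
    have "(\<lambda>s. \<lfloor>real (Suc n) * c s\<rfloor>) \<in> measurable M (count_space UNIV)"
      by measurable
    from measurable_compose_countable[OF meas this, of "\<lambda>i. of_int i / real (Suc n)"]
    show ?thesis unfolding q_def .
  qed
  fix s assume s: "s \<in> space M"
  have "(\<lambda>n. q n s) \<longlonglongrightarrow> c s"
  proof (rule LIMSEQ_I)
    fix r :: real assume "0 < r"
    then obtain N :: nat where N: "inverse (real (Suc N)) < r" using reals_Archimedean by blast
    have "norm (q n s - c s) < r" if "N \<le> n" for n
    proof -
      define k where "k = real (Suc n)"
      have "0 < k" by (simp add: k_def)
      have "\<bar>real_of_int \<lfloor>k * c s\<rfloor> - k * c s\<bar> / k \<le> 1 / k"
        using \<open>0 < k\<close> by (intro divide_right_mono) linarith+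
      moreover have "q n s - c s = (real_of_int \<lfloor>k * c s\<rfloor> - k * c s) / k"
        using \<open>0 < k\<close> by (simp add: q_def k_def diff_divide_distrib)
      ultimately have "\<bar>q n s - c s\<bar> \<le> inverse (real (Suc n))"
        using \<open>0 < k\<close> by (simp add: k_def inverse_eq_divide abs_divide)
      also have "\<dots> \<le> inverse (real (Suc N))" using that by (simp add: le_imp_inverse_le)
      finally show ?thesis using N by simp
    qed
    then show "\<exists>no. \<forall>n\<ge>no. norm (q n s - c s) < r" by blast
  qed
  then show "(\<lambda>n. f s (q n s)) \<longlonglongrightarrow> f s (c s)"
    using cont[OF s] by (metis UNIV_I continuous_on_tendsto_compose eventually_True
        continuous_on_eq_continuous_at isCont_tendsto_compose open_UNIV)
qed

lemma Picard_integral_equation: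
  fixes f :: "real \<Rightarrow> real \<Rightarrow> real"
  assumes "0 \<le> T" "0 < K"
    and meas: "\<And>z. (\<lambda>s. f s z) \<in> borel_measurable lebesgue"
    and bound: "\<And>s z. \<bar>f s z\<bar> \<le> M"
    and lip: "\<And>s y z. \<bar>f s y - f s z\<bar> \<le> K * \<bar>y - z\<bar>"
  shows "\<exists>!c. c \<in> extensional {0..T} \<and> continuous_on {0..T} c \<and>
    (\<forall>t\<in>{0..T}. c t = integral {0..t} (\<lambda>s. f s (c s)))"
proof -
  \<comment> \<open>Banach's theorem is applied to the complete space of bounded continuous
    functions on the whole line. Clamping time to \<open>{0..T}\<close> extends functions on the
    interval constantly beyond its ends.\<close>
  define r where "r = (\<lambda>t. max 0 (min T t))"
  have r: "r t \<in> {0..T}" "t \<in> {0..T} \<Longrightarrow> r t = t" for t using \<open>0 \<le> T\<close> by (auto simp: r_def)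
  have rr: "r (r t) = r t" for t using r by blast
  have cont_r: "continuous_on A r" for A unfolding r_def by (intro continuous_intros)
  have cont_f: "continuous_on UNIV (f s)" for s
    by (rule lipschitz_on_continuous_on[of K], rule lipschitz_onI)
      (use lip \<open>0 < K\<close> in \<open>auto simp: dist_real_def\<close>)
  have M: "0 \<le> M" using bound[of 0 0] by linarith
  define I where "I = (\<lambda>c t. integral {0..t} (\<lambda>s. f s (c s)))"
  have fmeas: "(\<lambda>s. f s (c s)) \<in> borel_measurable lebesgue" if "continuous_on UNIV c" for c
  proof (rule Caratheodory_measurable[OF meas cont_f])
    show "c \<in> borel_measurable lebesgue"
      by (rule measurable_completion) (simp add: borel_measurable_continuous_onI that)
  qed
  have fint: "(\<lambda>s. f s (c s)) integrable_on {a..b}" if "continuous_on UNIV c" for c a b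
    by (rule set_lebesgue_integral_eq_integral(1),
      rule set_integrable_lebesgue_bounded[OF fmeas[OF that]]) (use bound in auto)
  have I_cont: "continuous_on {0..T} (I c)" if "continuous_on UNIV c" for c
    unfolding I_def by (rule indefinite_integral_continuous_1[OF fint[OF that]])
  have I_bound: "\<bar>I c t\<bar> \<le> M * t" if "continuous_on UNIV c" "0 \<le> t" for c t
    using integral_AE_bounds[OF fmeas[OF that(1)], of "-M" M 0 t] bound that(2)
    by (auto simp: I_def abs_le_iff minus_le_iff)
  (* In the supremum norm weighted by 1/w, the integral operator contracts by 1/2 on all of [0,T]. *)
  define w where "w = (\<lambda>t. exp (2 * K * r t))"
  have w: "0 < w t" "w (r t) = w t" for t by (auto simp: w_def rr)
  have w1: "1 \<le> w t" for t using r(1)[of t] \<open>0 < K\<close> by (auto simp: w_def)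
  have cont_w: "continuous_on A w" for A unfolding w_def by (intro continuous_intros cont_r)
  \<comment> \<open>The integral operator conjugated by \<open>w\<close>: with
    \<open>c = w * u\<close>, the plain supremum norm of \<open>u\<close> is the weighted norm of
    \<open>c\<close>.\<close>
  define P where "P = (\<lambda>u t. I (\<lambda>s. w s * u s) (r t) / w t)"
  have cw: "continuous_on UNIV (\<lambda>s. w s * u s)" if "continuous_on UNIV u" for u
    by (intro continuous_intros cont_w that)
  have P_bc: "P u \<in> bcontfun" if "continuous_on UNIV u" for u
  proof (rule bcontfun_normI)
    show "continuous_on UNIV (P u)" unfolding P_def
      using w(1) by (intro continuous_intros cont_w
        continuous_on_compose2[OF I_cont[OF cw[OF that]] cont_r]) (use r in \<open>auto simp: less_imp_neq[symmetric]\<close>)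
    show "norm (P u t) \<le> M * T" for t
    proof -
      have "\<bar>P u t\<bar> \<le> \<bar>I (\<lambda>s. w s * u s) (r t)\<bar> / 1"
        unfolding P_def abs_divide using w1[of t] by (intro divide_left_mono) auto
      also have "\<dots> \<le> M * r t" using I_bound[OF cw[OF that], of "r t"] r(1)[of t] by simp
      also have "\<dots> \<le> M * T" using M r(1)[of t] by (intro mult_left_mono) auto
      finally show ?thesis by simp
    qed
  qed
  define Q where "Q = (\<lambda>u :: real \<Rightarrow>\<^sub>C real. Bcontfun (P (apply_bcontfun u)))"
  have Q: "apply_bcontfun (Q u) = P (apply_bcontfun u)" for u
    unfolding Q_def by (rule Bcontfun_inverse) (rule P_bc, simp)
  have contr: "dist (Q u) (Q v) \<le> 1/2 * dist u v" for u v
  proof (rule dist_bound)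
    fix t
    define D where "D = dist u v"
    have cu: "continuous_on UNIV (\<lambda>s. w s * apply_bcontfun u s)" for u :: "real \<Rightarrow>\<^sub>C real"
      by (rule cw) simp
    note iu = fint[OF cu[of u], of 0 "r t"] and iv = fint[OF cu[of v], of 0 "r t"]
    \<comment> \<open>The exponent \<open>2 * K\<close> is chosen here: integrating the Lipschitz
      bound \<open>K * D * w s\<close> gives at most \<open>D / 2 * w t\<close>, whence the factor
      1/2.\<close>
    have E: "((\<lambda>s. K * D * exp (2 * K * s)) has_integral
        (D / 2 * exp (2 * K * r t) - D / 2 * exp (2 * K * 0))) {0..r t}"
      by (rule fundamental_theorem_of_calculus)
        (use r(1)[of t] in \<open>auto intro!: derivative_eq_intros
          simp flip: has_real_derivative_iff_has_vector_derivative\<close>)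
    have "norm (integral {0..r t} (\<lambda>s. f s (w s * u s) - f s (w s * v s)))
        \<le> integral {0..r t} (\<lambda>s. K * D * exp (2 * K * s))"
    proof (rule integral_norm_bound_integral)
      show "(\<lambda>s. f s (w s * u s) - f s (w s * v s)) integrable_on {0..r t}"
        by (rule integrable_diff[OF iu iv])
      show "(\<lambda>s. K * D * exp (2 * K * s)) integrable_on {0..r t}" using E by blast
      fix s assume s: "s \<in> {0..r t}"
      then have ws: "w s = exp (2 * K * s)" using r(1)[of t] r(2)[of s] by (simp add: w_def)
      have "\<bar>f s (w s * u s) - f s (w s * v s)\<bar> \<le> K * \<bar>w s * u s - w s * v s\<bar>" by (rule lip)
      also have "\<bar>w s * u s - w s * v s\<bar> = w s * dist (u s) (v s)"
        using w(1)[of s] by (simp add: dist_real_def abs_mult flip: right_diff_distrib)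
      also have "\<dots> \<le> w s * D" unfolding D_def using w(1)[of s] by (intro mult_left_mono dist_bounded) auto
      finally show "norm (f s (w s * u s) - f s (w s * v s)) \<le> K * D * exp (2 * K * s)"
        using \<open>0 < K\<close> by (simp add: ws mult_ac)
    qed
    also have "\<dots> = D / 2 * w t - D / 2" using integral_unique[OF E] by (simp add: w_def)
    also have "\<dots> \<le> D / 2 * w t" by (simp add: D_def)
    finally have "\<bar>I (\<lambda>s. w s * u s) (r t) - I (\<lambda>s. w s * v s) (r t)\<bar> \<le> D / 2 * w t"
      unfolding I_def using integral_diff[OF iu iv] by simp
    then have "\<bar>P u t - P v t\<bar> \<le> D / 2"
      unfolding P_def diff_divide_distrib[symmetric] abs_divide using w(1)[of t]
      by (simp add: pos_divide_le_eq)
    then show "dist (Q u t) (Q v t) \<le> 1 / 2 * dist u v" by (simp add: Q dist_real_def D_def)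
  qed
  have fix1: "\<exists>!u. Q u = u"
    by (rule banach_fix_type[of "1/2"]) (use contr in auto)
  have I_cong: "I c t = I c' t" if "t \<in> {0..T}" "\<And>s. s \<in> {0..T} \<Longrightarrow> c s = c' s" for c c' t
    unfolding I_def by (rule integral_cong) (use that in auto)
  show ?thesis
  proof (rule ex_ex1I)
    obtain u where u: "Q u = u" using fix1 by blast
    define c where "c = restrict (\<lambda>t. w t * u t) {0..T}"
    have "c t = I c t" if "t \<in> {0..T}" for t
    proof -
      have "P u t = u t" using u Q[of u] by simp
      then have "w t * u t = I (\<lambda>s. w s * u s) t"
        using w(1)[of t] r(2)[OF that] by (simp add: P_def field_simps)
      also have "\<dots> = I c t" by (rule I_cong[OF that]) (simp add: c_def)
      finally show ?thesis using that by (simp add: c_def)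
    qed
    moreover have "continuous_on {0..T} c"
      by (rule continuous_on_eq[OF continuous_on_subset[OF cw[of u]]]) (auto simp: c_def)
    ultimately show "\<exists>c. c \<in> extensional {0..T} \<and> continuous_on {0..T} c \<and>
        (\<forall>t\<in>{0..T}. c t = integral {0..t} (\<lambda>s. f s (c s)))"
      unfolding I_def by (intro exI[of _ c]) (simp add: c_def)
  next
    \<comment> \<open>For uniqueness, every solution on \<open>{0..T}\<close>, extended constantly
      and divided by \<open>w\<close>, is a fixed point of \<open>Q\<close>; its values outside
      \<open>{0..T}\<close> never enter.\<close>
    have key: "\<exists>u. Q u = u \<and> (\<forall>t\<in>{0..T}. c t = w t * u t)"
      if c: "continuous_on {0..T} c" "\<forall>t\<in>{0..T}. c t = I c t" for c
    proof -
      define u where "u = (\<lambda>t. c (r t) / w t)"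
      have cu: "continuous_on UNIV u" unfolding u_def
        using w(1) by (intro continuous_intros cont_w continuous_on_compose2[OF c(1) cont_r])
          (use r in \<open>auto simp: less_imp_neq[symmetric]\<close>)
      have Pu: "P u = u"
      proof
        fix t
        have "I (\<lambda>s. w s * u s) (r t) = I c (r t)"
          by (rule I_cong) (use r w(1) in \<open>auto simp: u_def less_imp_neq[symmetric]\<close>)
        then show "P u t = u t" using c(2) r(1)[of t] by (simp add: P_def u_def)
      qed
      then have "u \<in> bcontfun" using P_bc[OF cu] by simp
      then have b: "apply_bcontfun (Bcontfun u) = u" by (rule Bcontfun_inverse)
      have "Q (Bcontfun u) = Bcontfun u" unfolding Q_def b Pu ..
      moreover have "c t = w t * u t" if "t \<in> {0..T}" for t
        using w(1)[of t] r(2)[OF that] by (simp add: u_def)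
      ultimately show ?thesis by (metis b)
    qed
    fix c c'
    assume c: "c \<in> extensional {0..T} \<and> continuous_on {0..T} c \<and>
        (\<forall>t\<in>{0..T}. c t = integral {0..t} (\<lambda>s. f s (c s)))"
      and c': "c' \<in> extensional {0..T} \<and> continuous_on {0..T} c' \<and>
        (\<forall>t\<in>{0..T}. c' t = integral {0..t} (\<lambda>s. f s (c' s)))"
    obtain u where u: "Q u = u" "\<forall>t\<in>{0..T}. c t = w t * u t"
      using key[of c] c unfolding I_def by blast
    obtain u' where u': "Q u' = u'" "\<forall>t\<in>{0..T}. c' t = w t * u' t"
      using key[of c'] c' unfolding I_def by blast
    have "u = u'" using fix1 u(1) u'(1) by blast
    then show "c = c'" using u(2) u'(2) c c' by (intro extensionalityI[of c "{0..T}" c']) auto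
  qed
qed

section \<open>Lipschitz functions are weakly differentiable\<close>

text \<open>Nonexpansiveness makes \<open>t - F t\<close> increasing as well. The Stieltjes measure
  of \<open>F\<close> is thus dominated by Lebesgue measure, which gives both its absolute
  continuity and the bound 1 on its density.\<close>

lemma nonexpansive_mono_has_density:
  fixes F :: "real \<Rightarrow> real"
  assumes F: "\<And>x y. x \<le> y \<Longrightarrow> F x \<le> F y \<and> F y - F x \<le> y - x"
  obtains f where "f \<in> borel_measurable borel" "\<And>s. 0 \<le> f s \<and> f s \<le> 1"
    "\<And>a b. a \<le> b \<Longrightarrow> (f has_integral (F b - F a)) {a..b}"
proof -
  define G where "G = (\<lambda>t. t - F t)"
  have F_mono: "x \<le> y \<Longrightarrow> F x \<le> F y" for x y using F by blast
  have G_mono: "x \<le> y \<Longrightarrow> G x \<le> G y" for x y using F[of x y] by (simp add: G_def)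
  have F_cont: "continuous_on UNIV F"
  proof (rule lipschitz_on_continuous_on[of 1], rule lipschitz_onI)
    show "dist (F x) (F y) \<le> 1 * dist x y" for x y
      using F[of x y] F[of y x] by (cases x y rule: le_cases) (auto simp: dist_real_def)
  qed simp
  have G_cont: "continuous_on UNIV G" unfolding G_def by (intro continuous_intros F_cont)
  \<comment> \<open>Lebesgue measure is recognised below by its values on open intervals, whereas
    Stieltjes measures are given on half-open ones; by continuity the right endpoint is
    null.\<close>
  have Ioo: "emeasure (interval_measure H) {l<..<u} = ennreal (H u - H l)"
    if mono: "\<And>x y. x \<le> y \<Longrightarrow> H x \<le> H y" and cont: "continuous_on UNIV H" and "l < u"
    for H :: "real \<Rightarrow> real" and l u
  proof -
    have "{u} \<in> null_sets (interval_measure H)"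
      using emeasure_interval_measure_Icc[OF order_refl mono cont, of u] by (simp add: null_sets_def)
    then have "emeasure (interval_measure H) ({l<..<u} \<union> {u}) = emeasure (interval_measure H) {l<..<u}"
      by (intro emeasure_Un_null_set) auto
    moreover have "{l<..<u} \<union> {u} = {l<..u}" using \<open>l < u\<close> by auto
    moreover have "continuous (at_right a) H" for a
      using cont by (auto simp: continuous_on_eq_continuous_at intro: continuous_at_imp_continuous_within)
    ultimately show ?thesis
      using emeasure_interval_measure_Ioc[of l u H] mono \<open>l < u\<close> by simp
  qed
  define \<mu> where "\<mu> = interval_measure F"
  define \<nu> where "\<nu> = interval_measure G"
  have [measurable_cong, simp]: "sets \<mu> = sets borel" "sets \<nu> = sets borel"
    by (simp_all add: \<mu>_def \<nu>_def)
  (* F + G is the identity, so N is Lebesgue measure; hence the densities of the two Stieltjes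
     measures add up to 1. *)
  define N where "N = measure_of UNIV (sets borel) (\<lambda>A. emeasure \<mu> A + emeasure \<nu> A)"
  have sets_N [simp]: "sets N = sets borel"
    unfolding N_def using sets.sigma_sets_eq[of "borel :: real measure"] by simp
  have N: "emeasure N A = emeasure \<mu> A + emeasure \<nu> A" if "A \<in> sets borel" for A
    unfolding N_def
  proof (rule emeasure_measure_of_sigma[OF _ _ _ that])
    show "sigma_algebra UNIV (sets (borel :: real measure))"
      using sets.sigma_algebra_axioms[of "borel :: real measure"] by simp
    show "positive (sets borel) (\<lambda>A. emeasure \<mu> A + emeasure \<nu> A)"
      by (simp add: positive_def)
    show "countably_additive (sets borel) (\<lambda>A. emeasure \<mu> A + emeasure \<nu> A)"
    proof (rule countably_additiveI)
      fix A :: "nat \<Rightarrow> real set"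
      assume A: "range A \<subseteq> sets borel" "disjoint_family A"
      show "(\<Sum>i. emeasure \<mu> (A i) + emeasure \<nu> (A i)) = emeasure \<mu> (\<Union> (range A)) + emeasure \<nu> (\<Union> (range A))"
        using suminf_emeasure[of A \<mu>] suminf_emeasure[of A \<nu>] A by (simp add: suminf_add[symmetric])
    qed
  qed
  have lborel_N: "lborel = N"
  proof (rule lborel_eqI)
    fix l u :: real assume *: "\<And>b. b \<in> Basis \<Longrightarrow> l \<bullet> b \<le> u \<bullet> b"
    show "emeasure N (box l u) = ennreal (\<Prod>b\<in>Basis. (u - l) \<bullet> b)"
    proof (cases "l < u")
      case True
      have "F u - F l + (G u - G l) = u - l" by (simp add: G_def)
      then show ?thesis
        using Ioo[OF F_mono F_cont True] Ioo[OF G_mono G_cont True] F_mono[of l u] G_mono[of l u] True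
        by (simp add: N box_real \<mu>_def \<nu>_def flip: ennreal_plus)
    next
      case False
      then show ?thesis using *[of 1] by (simp add: N box_real)
    qed
  qed simp
  have sum: "emeasure lborel A = emeasure \<mu> A + emeasure \<nu> A" if "A \<in> sets borel" for A
    unfolding lborel_N by (rule N[OF that])
  have ac: "absolutely_continuous lborel \<mu>" "absolutely_continuous lborel \<nu>"
    unfolding absolutely_continuous_def null_sets_def using sum by auto
  obtain p where p[measurable]: "p \<in> borel_measurable borel" and p_dens: "density lborel p = \<mu>"
    using sigma_finite_measure.Radon_Nikodym[OF lborel.sigma_finite_measure_axioms ac(1)] by auto
  obtain q where q[measurable]: "q \<in> borel_measurable borel" and q_dens: "density lborel q = \<nu>"
    using sigma_finite_measure.Radon_Nikodym[OF lborel.sigma_finite_measure_axioms ac(2)] by auto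
  \<comment> \<open>Both \<open>p + q\<close> and the constant 1 are densities of Lebesgue measure
    with respect to itself, and densities are unique almost everywhere.\<close>
  have "AE x in lborel. p x + q x = 1"
  proof (rule sigma_finite_measure.density_unique[OF lborel.sigma_finite_measure_axioms])
    show "density lborel (\<lambda>x. p x + q x) = density lborel (\<lambda>x. 1)"
    proof (rule measure_eqI)
      fix A :: "real set" assume "A \<in> sets (density lborel (\<lambda>x. p x + q x))"
      then have A[measurable]: "A \<in> sets borel" by simp
      have "emeasure (density lborel (\<lambda>x. p x + q x)) A
          = emeasure (density lborel p) A + emeasure (density lborel q) A"
        by (simp add: emeasure_density nn_integral_add distrib_right)
      also have "\<dots> = emeasure lborel A" using sum[OF A] by (simp add: p_dens q_dens)
      finally show "emeasure (density lborel (\<lambda>x. p x + q x)) A = emeasure (density lborel (\<lambda>x. 1)) A"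
        by (simp add: emeasure_density)
    qed simp
  qed simp_all
  then have p_le: "AE x in lborel. p x \<le> 1"
    by eventually_elim (metis le_iff_add)
  \<comment> \<open>\<open>p\<close> may exceed 1, or even be infinite, on a null set. Truncation at
    1 yields a real representative with its bounds valid everywhere.\<close>
  define f where "f = (\<lambda>s. enn2real (min 1 (p s)))"
  have f_meas[measurable]: "f \<in> borel_measurable borel" unfolding f_def by measurable
  have fin: "min 1 (p s) < top" for s by (simp add: min_less_iff_disj)
  have f_bounds: "0 \<le> f s \<and> f s \<le> 1" for s
    unfolding f_def using enn2real_mono[of "min 1 (p s)" 1] by simp
  have pf: "AE x in lborel. p x = ennreal (f x)"
    using p_le
  proof eventually_elim
    case (elim x)
    then show ?case using fin[of x] by (simp add: f_def min_absorb2)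
  qed
  have "(f has_integral (F b - F a)) {a..b}" if "a \<le> b" for a b
  proof -
    have "(\<integral>\<^sup>+x. ennreal (indicator {a..b} x * f x) \<partial>lborel) = (\<integral>\<^sup>+x. p x * indicator {a..b} x \<partial>lborel)"
      by (rule nn_integral_cong_AE) (use pf in \<open>eventually_elim, auto simp: indicator_def\<close>)
    also have "\<dots> = emeasure \<mu> {a..b}" by (simp add: emeasure_density flip: p_dens)
    also have "\<dots> = ennreal (F b - F a)"
      unfolding \<mu>_def by (rule emeasure_interval_measure_Icc[OF that F_mono F_cont])
    finally have "((\<lambda>x. indicator {a..b} x * f x) has_integral (F b - F a)) UNIV"
      by (intro nn_integral_has_integral[where f="\<lambda>x. indicator {a..b} x * f x"])
        (use f_bounds F_mono[OF that] in auto)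
    moreover have "(\<lambda>x. indicator {a..b} x * f x) = (\<lambda>x. if x \<in> {a..b} then f x else 0)"
      by (auto simp: indicator_def)
    ultimately show ?thesis by (simp only: has_integral_restrict_UNIV)
  qed
  with f_meas f_bounds show thesis by (rule that)
qed

lemma Lipschitz_imp_primitive:
  fixes h :: "real \<Rightarrow> real"
  assumes L: "0 < L" and h: "\<And>x y. \<bar>h x - h y\<bar> \<le> L * \<bar>x - y\<bar>"
  obtains g where "g \<in> borel_measurable borel" "\<And>s. \<bar>g s\<bar> \<le> L"
    "\<And>a b. a \<le> b \<Longrightarrow> (g has_integral (h b - h a)) {a..b}"
proof -
  \<comment> \<open>Adding slope \<open>L\<close> puts all difference quotients into
    \<open>[0, 2 * L]\<close>, and division by \<open>2 * L\<close> puts them into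
    \<open>[0, 1]\<close>. The density \<open>2 * L * f - L\<close> undoes both.\<close>
  define F where "F = (\<lambda>t. (h t + L * t) / (2 * L))"
  have "F x \<le> F y \<and> F y - F x \<le> y - x" if "x \<le> y" for x y
  proof
    have *: "h x - h y \<le> L * (y - x)" "h y - h x \<le> L * (y - x)"
      using h[of y x] that by auto
    show "F x \<le> F y"
      unfolding F_def using *(1) L by (intro divide_right_mono) (auto simp: right_diff_distrib)
    have "(h y + L * y - (h x + L * x)) / (2 * L) \<le> (2 * L * (y - x)) / (2 * L)"
      using *(2) L by (intro divide_right_mono) (auto simp: right_diff_distrib)
    then show "F y - F x \<le> y - x"
      using L by (simp add: F_def diff_divide_distrib)
  qed
  then obtain f where f: "f \<in> borel_measurable borel" "\<And>s. 0 \<le> f s \<and> f s \<le> 1"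
    "\<And>a b. a \<le> b \<Longrightarrow> (f has_integral (F b - F a)) {a..b}"
    by (rule nonexpansive_mono_has_density) blast+
  show thesis
  proof (rule that[of "\<lambda>s. 2 * L * f s - L"])
    show "(\<lambda>s. 2 * L * f s - L) \<in> borel_measurable borel" using f(1) by simp
    show "\<bar>2 * L * f s - L\<bar> \<le> L" for s
      using mult_left_mono[of "f s" 1 "2 * L"] f(2)[of s] L by (auto simp: abs_le_iff)
    fix a b :: real assume "a \<le> b"
    have "((\<lambda>s. 2 * L * f s - L) has_integral (2 * L * (F b - F a) - L * (b - a))) {a..b}"
      by (intro has_integral_diff has_integral_mult_right f(3) \<open>a \<le> b\<close>)
        (use has_integral_const_real[of L a b] \<open>a \<le> b\<close> in \<open>simp add: mult.commute\<close>)
    moreover have "2 * L * (F b - F a) - L * (b - a) = h b - h a"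
      using L by (simp add: F_def field_simps)
    ultimately show "((\<lambda>s. 2 * L * f s - L) has_integral (h b - h a)) {a..b}" by simp
  qed
qed

text \<open>Second order increments force the derivative to vanish everywhere. This replaces the
  product rule in the integration by parts, where one factor is only the primitive of a bounded
  function.\<close>

lemma constant_if_quadratic_increments:
  fixes D :: "real \<Rightarrow> real"
  assumes "a \<le> b"
    and D: "\<And>x y. a \<le> x \<Longrightarrow> x \<le> y \<Longrightarrow> y \<le> b \<Longrightarrow> \<bar>D y - D x\<bar> \<le> C * (y - x)\<^sup>2"
  shows "D b = D a"
proof -
  have D': "\<bar>D y - D x\<bar> \<le> C * \<bar>y - x\<bar>\<^sup>2" if "x \<in> {a..b}" "y \<in> {a..b}" for x y
    using D[of x y] D[of y x] that by (cases x y rule: le_cases) (auto simp: abs_minus_commute power2_commute)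
  have "(D has_derivative (\<lambda>_. 0)) (at x within {a..b})" if x: "x \<in> {a..b}" for x
  proof (rule has_derivativeI_sandwich[where e=1 and H="\<lambda>y. C * \<bar>y - x\<bar>"])
    show "((\<lambda>y. C * \<bar>y - x\<bar>) \<longlongrightarrow> 0) (at x within {a..b})"
      by (auto intro!: tendsto_eq_intros)
    fix y assume "y \<in> {a..b}" "y \<noteq> x"
    then show "norm (D y - D x - 0) / norm (y - x) \<le> C * \<bar>y - x\<bar>"
      using D'[OF x, of y] by (simp add: divide_le_eq power2_eq_square mult.assoc)
  qed auto
  then show ?thesis
    using has_derivative_zero_constant[of "{a..b}" D] \<open>a \<le> b\<close> by (metis atLeastAtMost_iff convex_real_interval(5) order_refl)
qed

lemma integration_by_parts_Lipschitz:
  fixes h g p p' :: "real \<Rightarrow> real"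
  assumes "a \<le> b" "0 \<le> L"
    and g: "g \<in> borel_measurable borel" "\<And>s. \<bar>g s\<bar> \<le> L"
    and hg: "\<And>a b. a \<le> b \<Longrightarrow> (g has_integral (h b - h a)) {a..b}"
    and p: "\<And>x. (p has_real_derivative p' x) (at x)" and p': "continuous_on UNIV p'"
  shows "integral {a..b} (\<lambda>s. g s * p s) + integral {a..b} (\<lambda>s. h s * p' s) = h b * p b - h a * p a"
proof -
  have h_lip: "\<bar>h y - h x\<bar> \<le> L * (y - x)" if "x \<le> y" for x y
    using has_integral_bound_real[OF \<open>0 \<le> L\<close> finite.emptyI hg[OF that]] g(2) that by simp
  have h_cont: "continuous_on UNIV h"
  proof (rule lipschitz_on_continuous_on[of L], rule lipschitz_onI)
    show "dist (h x) (h y) \<le> L * dist x y" for x y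
      using h_lip[of x y] h_lip[of y x]
      by (cases x y rule: le_cases) (auto simp: dist_real_def abs_minus_commute)
  qed fact
  have p_cont: "continuous_on A p" for A
    using p by (meson DERIV_isCont continuous_at_imp_continuous_on)
  obtain B where B: "0 \<le> B" "\<And>s. s \<in> {a..b} \<Longrightarrow> \<bar>p' s\<bar> \<le> B"
  proof -
    have "compact (p' ` {a..b})"
      by (intro compact_continuous_image continuous_on_subset[OF p'] compact_Icc) auto
    then obtain B where B: "\<forall>x\<in>p' ` {a..b}. norm x \<le> B"
      using compact_imp_bounded bounded_iff by blast
    show thesis by (rule that[of "max 0 B"]) (use B in \<open>force+\<close>)
  qed
  have p_lip: "\<bar>p y - p x\<bar> \<le> B * (y - x)" if "a \<le> x" "x \<le> y" "y \<le> b" for x y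
  proof -
    have "(p' has_integral (p y - p x)) {x..y}"
      by (rule fundamental_theorem_of_calculus)
        (use that p in \<open>auto simp: has_real_derivative_iff_has_vector_derivative
          intro: has_vector_derivative_at_within\<close>)
    from has_integral_bound_real[OF B(1) finite.emptyI this] show ?thesis using B(2) that by simp
  qed
  have gp: "(\<lambda>s. g s * p s) integrable_on {x..y}" for x y
  proof -
    have "compact (p ` {x..y})" by (intro compact_continuous_image p_cont compact_Icc)
    then have "bounded (p ` {x..y})" by (rule compact_imp_bounded)
    moreover have "set_integrable lebesgue {x..y} g"
      by (rule set_integrable_lebesgue_bounded[of _ L]) (use g in \<open>auto intro: measurable_completion\<close>)
    moreover have "p \<in> borel_measurable (lebesgue_on {x..y})"
      by (rule continuous_imp_measurable_on_sets_lebesgue[OF p_cont]) simp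
    ultimately have "set_integrable lebesgue {x..y} (\<lambda>s. p s * g s)"
      by (intro absolutely_integrable_bounded_measurable_product_real) auto
    then show ?thesis by (simp add: set_lebesgue_integral_eq_integral(1) mult.commute)
  qed
  have hp: "(\<lambda>s. h s * p' s) integrable_on {x..y}" for x y
    by (intro integrable_continuous_interval continuous_intros)
      (auto intro: continuous_on_subset[OF h_cont] continuous_on_subset[OF p'])
  define k where "k = (\<lambda>s. g s * p s + h s * p' s)"
  have k: "k integrable_on {x..y}" for x y unfolding k_def by (rule integrable_add[OF gp hp])
  \<comment> \<open>The defect of integration by parts on \<open>{a..t}\<close>; it is to be shown
    constant.\<close>
  define D where "D = (\<lambda>t. h t * p t - integral {a..t} k)"
  have "D b = D a"
  proof (rule constant_if_quadratic_increments[OF \<open>a \<le> b\<close>])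
    fix x y assume xy: "a \<le> x" "x \<le> y" "y \<le> b"
    have P: "(p' has_integral (p y - p x)) {x..y}"
      by (rule fundamental_theorem_of_calculus)
        (use xy p in \<open>auto simp: has_real_derivative_iff_has_vector_derivative
          intro: has_vector_derivative_at_within\<close>)
    have kI: "(k has_integral (integral {a..y} k - integral {a..x} k)) {x..y}"
    proof -
      have "integral {a..x} k + integral {x..y} k = integral {a..y} k"
        by (rule Henstock_Kurzweil_Integration.integral_combine[OF xy(1,2) k])
      then have "integral {x..y} k = integral {a..y} k - integral {a..x} k" by simp
      with integrable_integral[OF k[of x y]] show ?thesis by simp
    qed
    \<comment> \<open>The increment of the product \<open>h * p\<close> is written with
      \<open>p\<close> frozen at \<open>y\<close> and \<open>h\<close> frozen at \<open>x\<close>.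
      Subtracting \<open>k\<close> leaves an integrand of order \<open>y - x\<close>, whose integral
      is of order \<open>(y - x)^2\<close>.\<close>
    have "((\<lambda>s. p y * g s + h x * p' s - k s) has_integral
        (p y * (h y - h x) + h x * (p y - p x) - (integral {a..y} k - integral {a..x} k))) {x..y}"
      by (intro has_integral_diff has_integral_add has_integral_mult_right hg P kI xy)
    moreover have "p y * (h y - h x) + h x * (p y - p x) - (integral {a..y} k - integral {a..x} k) = D y - D x"
      by (simp add: D_def algebra_simps)
    ultimately have I: "((\<lambda>s. p y * g s + h x * p' s - k s) has_integral (D y - D x)) {x..y}" by simp
    have "norm (p y * g s + h x * p' s - k s) \<le> 2 * L * B * (y - x)" if s: "s \<in> {x..y}" for s
    proof -
      have "p y * g s + h x * p' s - k s = g s * (p y - p s) - (h s - h x) * p' s"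
        by (simp add: k_def algebra_simps)
      also have "\<bar>\<dots>\<bar> \<le> \<bar>g s\<bar> * \<bar>p y - p s\<bar> + \<bar>h s - h x\<bar> * \<bar>p' s\<bar>"
        by (simp flip: abs_mult)
      also have "\<dots> \<le> L * (B * (y - x)) + (L * (y - x)) * B"
      proof (rule add_mono; rule mult_mono)
        show "\<bar>p y - p s\<bar> \<le> B * (y - x)"
          using p_lip[of s y] s xy mult_left_mono[of "y - s" "y - x" B] B(1) by auto
        show "\<bar>h s - h x\<bar> \<le> L * (y - x)"
          using h_lip[of x s] s mult_left_mono[of "s - x" "y - x" L] \<open>0 \<le> L\<close> by auto
      qed (use g(2) B s xy \<open>0 \<le> L\<close> in auto)
      finally show ?thesis by (simp add: algebra_simps)
    qed
    with has_integral_bound_real[OF _ finite.emptyI I, of "2 * L * B * (y - x)"]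
    show "\<bar>D y - D x\<bar> \<le> 2 * L * B * (y - x)\<^sup>2"
      using xy \<open>0 \<le> L\<close> B(1) by (simp add: power2_eq_square mult.assoc)
  qed
  moreover have "integral {a..b} k = integral {a..b} (\<lambda>s. g s * p s) + integral {a..b} (\<lambda>s. h s * p' s)"
    unfolding k_def by (rule Henstock_Kurzweil_Integration.integral_add[OF gp hp])
  ultimately show ?thesis by (simp add: D_def)
qed

lemma Lipschitz_imp_W1inf:
  assumes L: "0 < L" and "0 \<le> T"
    and x: "\<And>s t. s \<in> {0..T} \<Longrightarrow> t \<in> {0..T} \<Longrightarrow> \<bar>x s - x t\<bar> \<le> L * \<bar>s - t\<bar>"
  shows "x \<in> W1inf {0<..<T}"
proof -
  \<comment> \<open>The constant extension of \<open>x\<close> beyond \<open>[0, T]\<close>;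
    clamping is nonexpansive, so the Lipschitz constant is kept on the whole line.\<close>
  define h where "h = (\<lambda>t. x (max 0 (min T t)))"
  have hx: "t \<in> {0<..<T} \<Longrightarrow> h t = x t" for t by (simp add: h_def)
  have h_lip: "\<bar>h s - h t\<bar> \<le> L * \<bar>s - t\<bar>" for s t
  proof -
    have "\<bar>h s - h t\<bar> \<le> L * \<bar>max 0 (min T s) - max 0 (min T t)\<bar>"
      unfolding h_def using \<open>0 \<le> T\<close> by (intro x) auto
    also have "\<dots> \<le> L * \<bar>s - t\<bar>" using L by (intro mult_left_mono) linarith+
    finally show ?thesis .
  qed
  have h_cont: "continuous_on UNIV h"
    by (rule lipschitz_on_continuous_on[of L], rule lipschitz_onI)
      (use h_lip L in \<open>auto simp: dist_real_def\<close>)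
  obtain g where g: "g \<in> borel_measurable borel" "\<And>s. \<bar>g s\<bar> \<le> L"
    "\<And>a b. a \<le> b \<Longrightarrow> (g has_integral (h b - h a)) {a..b}"
    using Lipschitz_imp_primitive[OF L h_lip] by blast
  have g_leb: "g \<in> borel_measurable lebesgue" and h_leb: "h \<in> borel_measurable lebesgue"
    using g(1) borel_measurable_continuous_onI[OF h_cont] by (auto intro: measurable_completion)
  have "x \<in> borel_measurable (lebesgue_on {0<..<T})"
    using measurable_restrict_space1[OF h_leb, of "{0<..<T}"]
    by (subst measurable_cong[of _ x h]) (auto simp: hx)
  moreover have "AE t in lebesgue_on {0<..<T}. \<bar>x t\<bar> \<le> \<bar>x 0\<bar> + L * T"
  proof (rule AE_I2)
    fix t assume "t \<in> space (lebesgue_on {0<..<T})"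
    then have "0 < t" "t < T" by auto
    moreover from this have "L * t \<le> L * T" using L by simp
    ultimately show "\<bar>x t\<bar> \<le> \<bar>x 0\<bar> + L * T" using x[of t 0] by auto
  qed
  ultimately have "x \<in> Linf {0<..<T}"
    unfolding Linf_iff by blast
  moreover have "is_weak_deriv {0<..<T} x g"
    unfolding is_weak_deriv_def
  proof (intro conjI ballI)
    show "g \<in> Linf {0<..<T}"
      unfolding Linf_iff using measurable_restrict_space1[OF g_leb] g(2) by blast
    fix p assume "p \<in> C1c {0<..<T}"
    then obtain p' where p: "\<And>x. (p has_real_derivative p' x) (at x)" "continuous_on UNIV p'"
      and supp: "closure {x. p x \<noteq> 0} \<subseteq> {0<..<T}"
      by (auto simp: C1c_def C1_differentiable_on_def simp flip: has_real_derivative_iff_has_vector_derivative)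
    \<comment> \<open>The support lies in the open interval, so the boundary terms of the
      integration by parts vanish.\<close>
    have p0: "p 0 = 0" "p T = 0"
      using supp closure_subset[of "{x. p x \<noteq> 0}"] by (meson greaterThanLessThan_iff mem_Collect_eq order_less_irrefl subsetD)+
    have p_cont: "continuous_on A p" for A
      using p by (meson DERIV_isCont continuous_at_imp_continuous_on)
    have gp: "set_integrable lebesgue {0..T} (\<lambda>s. g s * p s)"
    proof -
      have "compact (p ` {0..T})" by (intro compact_continuous_image p_cont compact_Icc)
      then have "bounded (p ` {0..T})" by (rule compact_imp_bounded)
      moreover have "set_integrable lebesgue {0..T} g"
        by (rule set_integrable_lebesgue_bounded[OF g_leb, of L]) (use g in auto)
      moreover have "p \<in> borel_measurable (lebesgue_on {0..T})"
        by (rule continuous_imp_measurable_on_sets_lebesgue[OF p_cont]) simp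
      ultimately have "set_integrable lebesgue {0..T} (\<lambda>s. p s * g s)"
        by (intro absolutely_integrable_bounded_measurable_product_real) auto
      then show ?thesis by (simp add: mult.commute)
    qed
    have hp: "set_integrable lebesgue {0..T} (\<lambda>s. h s * p' s)"
      by (intro absolutely_integrable_continuous_real continuous_intros)
        (auto intro: continuous_on_subset[OF h_cont] continuous_on_subset[OF p(2)])
    have "(LINT t:{0<..<T}|lebesgue. x t * deriv p t) = (LINT t:{0<..<T}|lebesgue. h t * p' t)"
      by (rule set_lebesgue_integral_cong) (auto simp: hx DERIV_imp_deriv[OF p(1)])
    also have "\<dots> = - (LINT t:{0<..<T}|lebesgue. g t * p t)"
      unfolding set_integral_lebesgue_Ioo[OF hp] set_integral_lebesgue_Ioo[OF gp]
      using integration_by_parts_Lipschitz[OF \<open>0 \<le> T\<close> less_imp_le[OF L] g p] p0 by simp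
    finally show "(LINT t:{0<..<T}|lebesgue. x t * deriv p t) = - (LINT t:{0<..<T}|lebesgue. g t * p t)" .
  qed
  ultimately show ?thesis unfolding W1inf_def by blast
qed

section \<open>The transformation by \<open>Z\<close>\<close>

text \<open>A closed set of full Lebesgue measure is the whole line.\<close>

lemma AE_lebesgue_abs_le_imp_all:
  fixes f :: "real \<Rightarrow> real"
  assumes cont: "continuous_on UNIV f" and ae: "AE x in lebesgue. \<bar>f x\<bar> \<le> C"
  shows "\<bar>f x\<bar> \<le> C"
proof -
  have "closed {x. \<bar>f x\<bar> \<le> C}"
    by (intro closed_Collect_le continuous_intros cont)
  from mem_closed_if_AE_lebesgue[OF this] ae show ?thesis by simp
qed

lemma Linf_norm_UNIV_leD:
  assumes "Linf_norm UNIV f \<le> ereal M"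
  shows "AE x in lebesgue. \<bar>f x\<bar> \<le> M"
proof -
  have "AE x in lebesgue_on UNIV. ereal \<bar>f x\<bar> \<le> Linf_norm UNIV f"
    unfolding Linf_norm_def by (rule esssup_AE)
  then have "AE x in lebesgue. ereal \<bar>f x\<bar> \<le> Linf_norm UNIV f"
    unfolding lebesgue_on_UNIV_eq .
  then show ?thesis
  proof eventually_elim
    case (elim x)
    then have "ereal \<bar>f x\<bar> \<le> ereal M" using assms by (rule order_trans)
    then show ?case by simp
  qed
qed

text \<open>\<open>W1inf_norm\<close> measures a chosen weak derivative, and membership in
  \<open>W1inf\<close> ensures that the choice denotes one. Both summands of the norm are
  nonnegative, so each is at most \<open>M\<close>; continuity of \<open>f\<close> makes the
  resulting bounds pointwise.\<close>

lemma W1inf_norm_le_imp_bounded_Lipschitz: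
  assumes "continuous_on UNIV f" "f \<in> W1inf UNIV" "W1inf_norm UNIV f \<le> ereal M"
  shows "\<bar>f y\<bar> \<le> M" "\<bar>f y - f z\<bar> \<le> M * \<bar>y - z\<bar>"
proof -
  define g where "g = (SOME g. is_weak_deriv UNIV f g)"
  have g: "is_weak_deriv UNIV f g"
  proof -
    obtain g0 where "is_weak_deriv UNIV f g0" using assms(2) by (auto simp: W1inf_def)
    then show ?thesis unfolding g_def by (rule someI[of "is_weak_deriv UNIV f"])
  qed
  have sum: "Linf_norm UNIV f + Linf_norm UNIV g \<le> ereal M"
    using assms(3) by (simp add: W1inf_norm_def g_def)
  have "Linf_norm UNIV f \<le> Linf_norm UNIV f + Linf_norm UNIV g"
    "Linf_norm UNIV g \<le> Linf_norm UNIV f + Linf_norm UNIV g"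
    by (simp_all add: add_increasing add_increasing2 Linf_norm_UNIV_nonneg)
  with sum have "Linf_norm UNIV f \<le> ereal M" "Linf_norm UNIV g \<le> ereal M"
    by (blast intro: order_trans)+
  then have f_ae: "AE x in lebesgue. \<bar>f x\<bar> \<le> M" and g_ae: "AE x in lebesgue. \<bar>g x\<bar> \<le> M"
    by (simp_all add: Linf_norm_UNIV_leD)
  have f_bound: "\<bar>f y\<bar> \<le> M" for y by (rule AE_lebesgue_abs_le_imp_all[OF assms(1) f_ae])
  then show "\<bar>f y\<bar> \<le> M" .
  have "0 \<le> M" using f_bound[of 0] by linarith
  note lip = weak_deriv_bounded_imp_Lipschitz[OF assms(1) g g_ae this]
  show "\<bar>f y - f z\<bar> \<le> M * \<bar>y - z\<bar>"
    using lip[of y z] lip[of z y] by (cases y z rule: linorder_cases) (auto simp: abs_minus_commute)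
qed

lemma Linf_W1infE:
  assumes "lam \<in> Linf_W1inf T"
  obtains K where "0 < K"
    "AE t in lebesgue_on {0<..<T}. \<forall>y z. \<bar>lam t y\<bar> \<le> K \<and> \<bar>lam t y - lam t z\<bar> \<le> K * \<bar>y - z\<bar>"
proof -
  obtain M where M: "AE t in lebesgue_on {0<..<T}.
      continuous_on UNIV (lam t) \<and> lam t \<in> W1inf UNIV \<and> W1inf_norm UNIV (lam t) \<le> ereal M"
    using assms by (auto simp: Linf_W1inf_def)
  \<comment> \<open>The maximum with 1 makes the constant strictly positive.\<close>
  have "AE t in lebesgue_on {0<..<T}. \<forall>y z. \<bar>lam t y\<bar> \<le> max 1 M \<and> \<bar>lam t y - lam t z\<bar> \<le> max 1 M * \<bar>y - z\<bar>"
    using M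
  proof eventually_elim
    case (elim t)
    then have "W1inf_norm UNIV (lam t) \<le> ereal (max 1 M)"
      by (meson ereal_less_eq(3) max.cobounded2 order_trans)
    with elim show ?case using W1inf_norm_le_imp_bounded_Lipschitz by blast
  qed
  then show thesis by (intro that[of "max 1 M"]) auto
qed

text \<open>The lower bound gives injectivity and the Lipschitz bound of the inverse. It also makes
  \<open>Z\<close> unbounded in both directions, so the intermediate value theorem gives
  surjectivity.\<close>

lemma bi_Lipschitz_bij:
  fixes Z :: "real \<Rightarrow> real"
  assumes "0 < m" and Z: "\<And>a b. a \<le> b \<Longrightarrow> m * (b - a) \<le> Z b - Z a \<and> Z b - Z a \<le> M * (b - a)"
  shows "bij Z" "continuous_on UNIV Z" "\<bar>inv Z p - inv Z q\<bar> \<le> \<bar>p - q\<bar> / m"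
proof -
  have M: "0 \<le> M" using Z[of 0 1] \<open>0 < m\<close> by auto
  have lower: "m * \<bar>a - b\<bar> \<le> \<bar>Z a - Z b\<bar>" for a b
    using Z[of a b] Z[of b a] by (cases a b rule: le_cases) auto
  have upper: "\<bar>Z a - Z b\<bar> \<le> M * \<bar>a - b\<bar>" for a b
  proof (cases a b rule: le_cases)
    case le
    then have "0 \<le> m * (b - a)" using \<open>0 < m\<close> by simp
    then show ?thesis using Z[OF le] le by auto
  next
    case ge
    then have "0 \<le> m * (a - b)" using \<open>0 < m\<close> by simp
    then show ?thesis using Z[OF ge] ge by auto
  qed
  show cont: "continuous_on UNIV Z"
    by (rule lipschitz_on_continuous_on[of M], rule lipschitz_onI)
      (use upper M in \<open>auto simp: dist_real_def\<close>)
  have "inj Z"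
  proof (rule injI)
    fix a b assume "Z a = Z b"
    then have "m * \<bar>a - b\<bar> \<le> 0" using lower[of a b] by simp
    then show "a = b" using \<open>0 < m\<close> by (simp add: mult_le_0_iff)
  qed
  moreover have "\<exists>x. Z x = y" for y
  proof -
    \<comment> \<open>Growth at rate at least \<open>m\<close> over the distance \<open>r\<close>
      covers \<open>\<bar>y - Z 0\<bar>\<close>, so \<open>y\<close> lies between
      \<open>Z (-r)\<close> and \<open>Z r\<close>.\<close>
    define r where "r = \<bar>y - Z 0\<bar> / m"
    have "0 \<le> r" and mr: "m * r = \<bar>y - Z 0\<bar>" using \<open>0 < m\<close> by (auto simp: r_def)
    then have "Z (-r) \<le> y" "y \<le> Z r" using Z[of 0 r] Z[of "-r" 0] by auto
    then show ?thesis
      using IVT'[of Z "-r" y r] \<open>0 \<le> r\<close> continuous_on_subset[OF cont] by auto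
  qed
  ultimately show "bij Z" by (metis bijI surj_def)
  then have "Z (inv Z p) = p" "Z (inv Z q) = q" by (simp_all add: bij_is_surj surj_f_inv_f)
  with lower[of "inv Z p" "inv Z q"] show "\<bar>inv Z p - inv Z q\<bar> \<le> \<bar>p - q\<bar> / m"
    using \<open>0 < m\<close> by (simp add: field_simps)
qed

text \<open>Increments of \<open>Zmap\<close> are integrals of \<open>1 / w\<close>, which is
  essentially bounded between positive constants. The base point cancels, so one \<open>V\<close>
  serves all of them.\<close>

lemma Zmap_bi_Lipschitz:
  assumes w: "w \<in> Linf_ge vmin" and "0 < vmin"
  obtains V where "0 < V"
    "\<And>y0 a b. a \<le> b \<Longrightarrow> 1 / V * (b - a) \<le> Zmap w y0 b - Zmap w y0 a
      \<and> Zmap w y0 b - Zmap w y0 a \<le> 1 / vmin * (b - a)"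
proof -
  have w_meas: "w \<in> borel_measurable lebesgue" and w_ge: "AE x in lebesgue. vmin \<le> w x"
    using w by (auto simp: Linf_ge_def Linf_iff lebesgue_on_UNIV_eq)
  obtain C where C: "AE x in lebesgue. \<bar>w x\<bar> \<le> C"
    using w unfolding Linf_ge_def Linf_iff lebesgue_on_UNIV_eq by blast
  define V where "V = max 1 C"
  have "0 < V" by (simp add: V_def)
  have meas: "(\<lambda>x. 1 / w x) \<in> borel_measurable lebesgue" using w_meas by simp
  have ae: "AE x in lebesgue. 1 / V \<le> 1 / w x \<and> 1 / w x \<le> 1 / vmin"
    using w_ge C
  proof eventually_elim
    case (elim x)
    then show ?case using \<open>0 < vmin\<close> \<open>0 < V\<close> by (auto simp: V_def intro!: divide_left_mono)
  qed
  then have "AE x in lebesgue. \<bar>1 / w x\<bar> \<le> 1 / vmin"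
  proof eventually_elim
    case (elim x)
    moreover have "0 \<le> 1 / V" using \<open>0 < V\<close> by simp
    ultimately show ?case by linarith
  qed
  note diff = interval_lebesgue_integral_diff[OF meas this]
  show thesis
  proof (rule that[OF \<open>0 < V\<close>])
    fix y0 a b :: real assume "a \<le> b"
    show "1 / V * (b - a) \<le> Zmap w y0 b - Zmap w y0 a
        \<and> Zmap w y0 b - Zmap w y0 a \<le> 1 / vmin * (b - a)"
      unfolding Zmap_def diff[OF \<open>a \<le> b\<close>] using integral_AE_bounds[OF meas ae \<open>a \<le> b\<close>] by blast
  qed
qed

text \<open>\<open>Xsol\<close> and \<open>Csol\<close> are definite descriptions; the first and
  fourth conjuncts are what make them denote the solutions that the other conjuncts speak
  of.\<close>

theorem theorem2p1:
  fixes T vmin x0 :: real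
    and v :: "real \<Rightarrow> real"
    and lam :: "real \<Rightarrow> real \<Rightarrow> real"
  assumes "T > 0"
    and "vmin > 0"
    and "v \<in> Linf_ge vmin"
    and "lam \<in> Linf_W1inf T"
  shows "(\<exists>!x. x \<in> extensional {0..T} \<and> integral_solution T v lam x0 x)
       \<and> Xsol T v lam x0 \<in> W1inf {0<..<T}
       \<and> (\<forall>y0. \<forall>w\<in>Linf_ge vmin. bij (Zmap w y0))
       \<and> (\<exists>!c. c \<in> extensional {0..T} \<and> C_solution T lam (Zmap v x0) c)
       \<and> (\<forall>t\<in>{0..T}. Xsol T v lam x0 t = inv (Zmap v x0) (Csol T lam (Zmap v x0) t))"
proof -
  have bij_Zmap: "bij (Zmap w y0)" if w: "w \<in> Linf_ge vmin" for w y0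
  proof -
    obtain V where "0 < V" "\<And>y0 a b. a \<le> b \<Longrightarrow> 1 / V * (b - a) \<le> Zmap w y0 b - Zmap w y0 a
        \<and> Zmap w y0 b - Zmap w y0 a \<le> 1 / vmin * (b - a)"
      using Zmap_bi_Lipschitz[OF w \<open>vmin > 0\<close>] by blast
    then show ?thesis using bi_Lipschitz_bij(1)[of "1 / V" "Zmap w y0" "1 / vmin"] by simp
  qed

  \<comment> \<open>The transformation \<open>Z\<close> and its Lipschitz inverse
    \<open>Y\<close>\<close>
  define Z where "Z = Zmap v x0"
  define Y where "Y = inv Z"
  have "bij Z" unfolding Z_def by (rule bij_Zmap[OF assms(3)])
  then have YZ: "Y (Z x) = x" and ZY: "Z (Y z) = z" for x z
    by (simp_all add: Y_def bij_is_inj bij_is_surj surj_f_inv_f)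
  obtain V where "0 < V" and V: "\<And>y0 a b. a \<le> b \<Longrightarrow> 1 / V * (b - a) \<le> Zmap v y0 b - Zmap v y0 a
      \<and> Zmap v y0 b - Zmap v y0 a \<le> 1 / vmin * (b - a)"
    using Zmap_bi_Lipschitz[OF assms(3,2)] by blast
  have Z_cont: "continuous_on UNIV Z"
    unfolding Z_def using bi_Lipschitz_bij(2)[of "1 / V" "Zmap v x0" "1 / vmin"] V \<open>0 < V\<close> by simp
  have Y_lip: "\<bar>Y p - Y q\<bar> \<le> V * \<bar>p - q\<bar>" for p q
    unfolding Y_def Z_def
    using bi_Lipschitz_bij(3)[of "1 / V" "Zmap v x0" "1 / vmin" p q] V \<open>0 < V\<close> by (simp add: mult.commute)
  have Y_cont: "continuous_on UNIV Y"
    by (rule lipschitz_on_continuous_on[of V], rule lipschitz_onI)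
      (use Y_lip \<open>0 < V\<close> in \<open>auto simp: dist_real_def\<close>)

  \<comment> \<open>The transformed right-hand side\<close>
  obtain K where "0 < K" and K: "AE t in lebesgue_on {0<..<T}.
      \<forall>y z. \<bar>lam t y\<bar> \<le> K \<and> \<bar>lam t y - lam t z\<bar> \<le> K * \<bar>y - z\<bar>"
    using Linf_W1infE[OF assms(4)] by blast
  have "AE t in lebesgue. t \<in> {0<..<T} \<longrightarrow>
      (\<forall>y z. \<bar>lam t y\<bar> \<le> K \<and> \<bar>lam t y - lam t z\<bar> \<le> K * \<bar>y - z\<bar>)"
    using K by (subst (asm) AE_restrict_space_iff) auto
  then obtain N where N: "N \<in> null_sets lebesgue"
    and good: "\<And>t y z. t \<in> {0<..<T} \<Longrightarrow> t \<notin> N \<Longrightarrow>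
        \<bar>lam t y\<bar> \<le> K \<and> \<bar>lam t y - lam t z\<bar> \<le> K * \<bar>y - z\<bar>"
    unfolding eventually_ae_filter by auto
  (* Bounded and Lipschitz for every s, not only almost every s. *)
  define f where "f = (\<lambda>s z. if s \<in> {0<..<T} \<and> s \<notin> N then lam s (Y z) else 0)"
  have f_meas: "(\<lambda>s. f s z) \<in> borel_measurable lebesgue" for z
  proof -
    have "(\<lambda>s. lam s (Y z)) \<in> borel_measurable (lebesgue_on {0<..<T})"
      using assms(4) by (simp add: Linf_W1inf_def)
    then have "(\<lambda>s. if s \<in> {0<..<T} then lam s (Y z) else 0) \<in> borel_measurable lebesgue"
      by (rule borel_measurable_if_I) simp
    \<comment> \<open>Lebesgue measure is complete, so changing the integrand on the null set
      \<open>N\<close> keeps it measurable.\<close>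
    then show ?thesis
    proof (rule borel_measurable_lebesgue_AE_cong)
      show "AE s in lebesgue. (if s \<in> {0<..<T} then lam s (Y z) else 0) = f s z"
        using AE_not_in[OF N] by eventually_elim (simp add: f_def)
    qed
  qed
  have f_bound: "\<bar>f s z\<bar> \<le> K" for s z using good \<open>0 < K\<close> by (simp add: f_def)
  have f_lip: "\<bar>f s y - f s z\<bar> \<le> K * V * \<bar>y - z\<bar>" for s y z
  proof (cases "s \<in> {0<..<T} \<and> s \<notin> N")
    case True
    then have "\<bar>f s y - f s z\<bar> \<le> K * \<bar>Y y - Y z\<bar>" using good by (simp add: f_def)
    also have "\<dots> \<le> K * (V * \<bar>y - z\<bar>)" using Y_lip \<open>0 < K\<close> by (intro mult_left_mono) auto
    finally show ?thesis by (simp add: mult.assoc)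
  next
    case False
    then have "f s z = 0" for z by (auto simp: f_def)
    then show ?thesis using \<open>0 < K\<close> \<open>0 < V\<close> by simp
  qed
  have f_cont: "continuous_on UNIV (f s)" for s
    by (rule lipschitz_on_continuous_on[of "K * V"], rule lipschitz_onI)
      (use f_lip \<open>0 < K\<close> \<open>0 < V\<close> in \<open>auto simp: dist_real_def\<close>)

  \<comment> \<open>Solving the transformed integral equation\<close>
  define r where "r = (\<lambda>t. max 0 (min T t))"
  have r: "r t \<in> {0..T}" "t \<in> {0..T} \<Longrightarrow> r t = t" for t using \<open>T > 0\<close> by (auto simp: r_def)
  have r_cont: "continuous_on UNIV r" unfolding r_def by (intro continuous_intros)
  \<comment> \<open>\<open>c\<close> is continuous on \<open>{0..T}\<close> only and arbitrary
    outside; clamping time makes it continuous on the whole line without changing it on the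
    interval.\<close>
  have fr_meas: "(\<lambda>s. f s (c (r s))) \<in> borel_measurable lebesgue" if c: "continuous_on {0..T} c" for c
  proof (rule Caratheodory_measurable[OF f_meas f_cont])
    have "continuous_on UNIV (\<lambda>s. c (r s))"
      by (rule continuous_on_compose2[OF c r_cont]) (use r in auto)
    then show "(\<lambda>s. c (r s)) \<in> borel_measurable lebesgue"
      by (intro measurable_completion) (simp add: borel_measurable_continuous_onI)
  qed
  have fr_integrable: "set_integrable lebesgue {a..b} (\<lambda>s. f s (c (r s)))"
    if c: "continuous_on {0..T} c" for c a b
    by (rule set_integrable_lebesgue_bounded[OF fr_meas[OF c], of K]) (simp add: f_bound)
  have lam_integral: "(LINT s=0..ereal t|lebesgue. lam s (Y (c s))) = integral {0..t} (\<lambda>s. f s (c (r s)))"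
    if c: "continuous_on {0..T} c" and t: "t \<in> {0..T}" for c t
  proof -
    define F where "F = (\<lambda>s. indicat_real {0<..<t} s * f s (c (r s)))"
    define G where "G = (\<lambda>s. indicat_real {0<..<t} s * lam s (Y (c s)))"
    have F: "F \<in> borel_measurable lebesgue" 
    unfolding F_def by (rule borel_measurable_times[OF borel_measurable_indicator fr_meas[OF c]]) simp
    \<comment> \<open>Off \<open>N\<close> the two agree. Completeness then transfers measurability
      from \<open>F\<close> to \<open>G\<close>, where it is not evident directly.\<close>
    have FG: "AE s in lebesgue. F s = G s"
      using AE_not_in[OF N]
      by eventually_elim (use t r in \<open>auto simp: F_def G_def f_def indicator_def\<close>)
    \<comment> \<open>The interval integral runs over the open interval, so the uncontrolled values
      of \<open>lam\<close> at times 0 and \<open>T\<close> do not enter.\<close>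
    have "(LINT s=0..ereal t|lebesgue. lam s (Y (c s))) = integral\<^sup>L lebesgue G"
      using t by (simp add: zero_ereal_def interval_lebesgue_integral_le_eq set_lebesgue_integral_def G_def)
    also have "\<dots> = integral\<^sup>L lebesgue F"
      by (rule integral_cong_AE)
        (use F FG borel_measurable_lebesgue_AE_cong[OF F FG] in \<open>auto elim: eventually_mono\<close>)
    also have "\<dots> = integral {0..t} (\<lambda>s. f s (c (r s)))"
      using set_integral_lebesgue_Ioo[OF fr_integrable[OF c], of 0 t]
      by (simp add: set_lebesgue_integral_def F_def)
    finally show ?thesis .
  qed
  have r_integral: "integral {0..t} (\<lambda>s. f s (c (r s))) = integral {0..t} (\<lambda>s. f s (c s))"
    if "t \<in> {0..T}" for c t
    by (rule integral_cong) (use that r in auto)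
  have C_iff: "C_solution T lam Z c \<longleftrightarrow> continuous_on {0..T} c \<and>
      (\<forall>t\<in>{0..T}. c t = integral {0..t} (\<lambda>s. f s (c s)))" for c
    unfolding C_solution_def Y_def[symmetric] using lam_integral[of c] r_integral[of _ c] by auto
  have C_ex1: "\<exists>!c. c \<in> extensional {0..T} \<and> C_solution T lam Z c"
    unfolding C_iff
    by (rule Picard_integral_equation[of T "K * V" f K])
      (use assms(1) \<open>0 < K\<close> \<open>0 < V\<close> f_meas f_bound f_lip in auto)

  \<comment> \<open>Correspondence between the solutions \<open>x\<close> and
    \<open>c\<close>\<close>
  have lam_cong: "(LINT s=0..ereal t|lebesgue. lam s (u s)) = (LINT s=0..ereal t|lebesgue. lam s (w s))"
    if "\<And>s. s \<in> {0..T} \<Longrightarrow> u s = w s" "t \<in> {0..T}" for u w t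
    using that by (auto simp: zero_ereal_def interval_lebesgue_integral_le_eq intro!: set_lebesgue_integral_cong)
  \<comment> \<open>Cutting down to \<open>{0..T}\<close> makes the image extensional, so that the
    uniqueness of \<open>c\<close> applies to it.\<close>
  have to_C: "C_solution T lam Z (restrict (\<lambda>t. Z (x t)) {0..T})"
    if x: "integral_solution T v lam x0 x" for x
    unfolding C_solution_def
  proof (intro conjI ballI)
    have "continuous_on {0..T} (\<lambda>t. Z (x t))"
      using x by (intro continuous_on_compose2[OF Z_cont]) (auto simp: integral_solution_def)
    then show "continuous_on {0..T} (restrict (\<lambda>t. Z (x t)) {0..T})"
      by (rule continuous_on_eq) simp
    fix t assume t: "t \<in> {0..T}"
    then have "Z (x t) = (LINT s=0..ereal t|lebesgue. lam s (x s))"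
      using x by (simp add: integral_solution_def Z_def Zmap_def)
    also have "\<dots> = (LINT s=0..ereal t|lebesgue. lam s (inv Z (restrict (\<lambda>t. Z (x t)) {0..T} s)))"
      by (rule lam_cong[OF _ t]) (simp add: YZ flip: Y_def)
    finally show "restrict (\<lambda>t. Z (x t)) {0..T} t = \<dots>" using t by simp
  qed
  have from_C: "integral_solution T v lam x0 (restrict (\<lambda>t. Y (c t)) {0..T})"
    if c: "C_solution T lam Z c" for c
    unfolding integral_solution_def Zmap_def[symmetric] Z_def[symmetric]
  proof (intro conjI ballI)
    have "continuous_on {0..T} (\<lambda>t. Y (c t))"
      using c by (intro continuous_on_compose2[OF Y_cont]) (auto simp: C_solution_def)
    then show "continuous_on {0..T} (restrict (\<lambda>t. Y (c t)) {0..T})"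
      by (rule continuous_on_eq) simp
    fix t assume t: "t \<in> {0..T}"
    then have "Z (restrict (\<lambda>t. Y (c t)) {0..T} t) = (LINT s=0..ereal t|lebesgue. lam s (Y (c s)))"
      using c by (simp add: C_solution_def ZY flip: Y_def)
    also have "\<dots> = (LINT s=0..ereal t|lebesgue. lam s (restrict (\<lambda>t. Y (c t)) {0..T} s))"
      by (rule lam_cong[OF _ t]) simp
    finally show "Z (restrict (\<lambda>t. Y (c t)) {0..T} t) = \<dots>" .
  qed
  define c where "c = Csol T lam Z"
  have c: "c \<in> extensional {0..T}" "C_solution T lam Z c"
    using theI'[OF C_ex1] by (auto simp: c_def Csol_def)
  define x where "x = restrict (\<lambda>t. Y (c t)) {0..T}"
  have x: "x \<in> extensional {0..T} \<and> integral_solution T v lam x0 x"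
    using from_C[OF c(2)] by (simp add: x_def)
  have x_unique: "y = x" if y: "y \<in> extensional {0..T} \<and> integral_solution T v lam x0 y" for y
  proof (rule extensionalityI[of _ "{0..T}"])
    \<comment> \<open>The image of \<open>y\<close> under \<open>Z\<close> solves the equation for
      \<open>c\<close> and hence is \<open>c\<close>; applying \<open>Y\<close> recovers
      \<open>y\<close>.\<close>
    have "c = restrict (\<lambda>t. Z (y t)) {0..T}"
      unfolding c_def Csol_def by (rule the1_equality[OF C_ex1]) (use to_C y in simp)
    then show "y t = x t" if "t \<in> {0..T}" for t
      using that YZ[of "y t"] by (auto simp: x_def)
  qed (use y x in auto)
  have X: "Xsol T v lam x0 = x"
    unfolding Xsol_def using x x_unique by (rule the_equality)

  \<comment> \<open>Lipschitz regularity of the solution\<close>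
  have c_lip: "\<bar>c t - c s\<bar> \<le> K * (t - s)" if "s \<in> {0..T}" "t \<in> {0..T}" "s \<le> t" for s t
  proof -
    have cc: "continuous_on {0..T} c" using c(2) C_iff by blast
    have "c u = (LINT s=ereal 0..ereal u|lebesgue. f s (c (r s)))" if u: "u \<in> {0..T}" for u
      using interval_lebesgue_integral_eq_integral[OF _ fr_integrable[OF cc], of 0 u] u
        c(2) C_iff r_integral[OF u, of c] by auto
    then have "c t - c s = integral {s..t} (\<lambda>s. f s (c (r s)))"
      using interval_lebesgue_integral_diff[OF fr_meas[OF cc], of K s t 0] f_bound that by simp
    then show ?thesis
      using integral_AE_bounds[OF fr_meas[OF cc], of "-K" K s t] f_bound that
      by (auto simp: abs_le_iff minus_le_iff)
  qed
  have "x \<in> W1inf {0<..<T}"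
  proof (rule Lipschitz_imp_W1inf)
    \<comment> \<open>The product of the Lipschitz constants of \<open>Y\<close> and of
      \<open>c\<close>, the latter being the bound on \<open>f\<close>.\<close>
    show "0 < V * K" using \<open>0 < V\<close> \<open>0 < K\<close> by simp
    show "0 \<le> T" using assms(1) by simp
    fix s t assume st: "s \<in> {0..T}" "t \<in> {0..T}"
    have "\<bar>x s - x t\<bar> \<le> V * \<bar>c s - c t\<bar>" using Y_lip st by (simp add: x_def)
    also have "\<bar>c s - c t\<bar> \<le> K * \<bar>s - t\<bar>"
      using c_lip[of s t] c_lip[of t s] st by (cases s t rule: le_cases) (auto simp: abs_minus_commute)
    finally show "\<bar>x s - x t\<bar> \<le> V * K * \<bar>s - t\<bar>" using \<open>0 < V\<close> by (simp add: mult.assoc)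
  qed
  moreover have "\<exists>!x. x \<in> extensional {0..T} \<and> integral_solution T v lam x0 x"
    using x x_unique by blast
  moreover have "\<forall>t\<in>{0..T}. x t = inv Z (c t)" by (simp add: x_def Y_def)
  ultimately show ?thesis using bij_Zmap C_ex1 X by (auto simp: Z_def[symmetric] c_def)
qed

end
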